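(* If an algebra $H\in\Theta$ is logically noetherian, then $H$ is LG-saturated.
   Context: Fix a variety $\Theta$, an infinite set of variables $X^0$, and let $\Gamma$ be the set of finite subsets of $X^0$; $W(X)$ is the free algebra of $\Theta$ over $X$. For $H\in\Theta$, $\mathrm{Hal}^X_\Theta(H)$ is the Boolean algebra of subsets of $\mathrm{Hom}(W(X),H)$ with quantifiers ($\mu\in\exists xA$ iff some $\nu\in A$ agrees with $\mu$ off $x$), equalities $[w\equiv w']_H=\{\mu:\mu(w)=\mu(w')\}$ and maps $s_*(A)=\{\mu:\mu\circ s\in A\}$ for homomorphisms $s:W(X)\to W(Y)$. The multi-sorted algebra of formulas $\Phi=(\Phi(X),X\in\Gamma)$ is the free Halmos algebra (multi-sorted algebras with sorts extended Boolean algebras with quantifiers $\exists x$, equalities $w\equiv w'$, and operations $s_*$, satisfying the Halmos axioms) over the sets of formal equalities $w\equiv w'$, $w,w'\in W(X)$; each $\Phi(X)$ is a Boolean algebra. $\mathrm{Val}^X_H:\Phi(X)\to\mathrm{Hal}^X_\Theta(H)$ are the components of the unique homomorphism sending $w\equiv w'$ to $[w\equiv w']_H$. A point $\mu:W(X)\to H$ satisfies $u$ iff $\mu\in\mathrm{Val}^X_H(u)$; $\mathrm{LKer}(\mu)$ is the set of formulas satisfied by $\mu$. $\mathrm{Th}^X(H)=\{u\in\Phi(X):\mathrm{Val}^X_H(u)=\mathrm{Hom}(W(X),H)\}$. For $T\subseteq\Phi(X)$, $T^L_H=\{\mu:T\subseteq\mathrm{LKer}(\mu)\}$. $H$ is logically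 noetherian if for every $X\in\Gamma$ and every $T\subseteq\Phi(X)$ there is a finite $T_0\subseteq T$ with $(T_0)^L_H=T^L_H$. $H$ is LG-saturated if for every $X\in\Gamma$, every Boolean ultrafilter $T$ of $\Phi(X)$ containing $\mathrm{Th}^X(H)$ equals $\mathrm{LKer}(\mu)$ for some point $\mu:W(X)\to H$. *)

theory Defs
  imports "HOL-Library.FuncSet"
begin

section \<open>Algebras, homomorphisms, varieties\<close>

record ('f, 'a) algebra =
  Carr :: "'a set"
  Op :: "'f \<Rightarrow> 'a list \<Rightarrow> 'a"

datatype ('f, 'x) tm = Var 'x | App 'f "('f, 'x) tm list"

text \<open>The variables of the set \<open>X\<^sup>0\<close> are the elements of the type \<open>'x\<close>. A variety is an equational
  class: a (possibly empty) set of operation symbols paired with their finite arities, and a set of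
  identities in variables from \<open>X\<^sup>0\<close>. As \<open>X\<^sup>0\<close> is infinite, every variety has this form.\<close>

record ('f, 'x) variety =
  sig :: "('f \<times> nat) set"
  ids :: "(('f, 'x) tm \<times> ('f, 'x) tm) set"

inductive_set terms :: "('f \<times> nat) set \<Rightarrow> 'x set \<Rightarrow> ('f, 'x) tm set"
  for \<Omega> :: "('f \<times> nat) set" and X :: "'x set" where
  var: "x \<in> X \<Longrightarrow> Var x \<in> terms \<Omega> X"
| app: "(f, length ts) \<in> \<Omega> \<Longrightarrow> (\<And>t. t \<in> set ts \<Longrightarrow> t \<in> terms \<Omega> X) \<Longrightarrow> App f ts \<in> terms \<Omega> X"

primrec subst :: "('x \<Rightarrow> ('f, 'y) tm) \<Rightarrow> ('f, 'x) tm \<Rightarrow> ('f, 'y) tm" where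
  "subst \<sigma> (Var x) = \<sigma> x"
| "subst \<sigma> (App f ts) = App f (map (subst \<sigma>) ts)"

primrec tm_val :: "('f, 'a) algebra \<Rightarrow> ('x \<Rightarrow> 'a) \<Rightarrow> ('f, 'x) tm \<Rightarrow> 'a" where
  "tm_val A v (Var x) = v x"
| "tm_val A v (App f ts) = Op A f (map (tm_val A v) ts)"

definition wf_variety :: "('f, 'x) variety \<Rightarrow> bool" where
  "wf_variety \<Theta> \<longleftrightarrow> ids \<Theta> \<subseteq> terms (sig \<Theta>) UNIV \<times> terms (sig \<Theta>) UNIV"

definition is_algebra :: "('f \<times> nat) set \<Rightarrow> ('f, 'a) algebra \<Rightarrow> bool" where
  "is_algebra \<Omega> A \<longleftrightarrow>
     (\<forall>f as. (f, length as) \<in> \<Omega> \<and> set as \<subseteq> Carr A \<longrightarrow> Op A f as \<in> Carr A)"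

definition in_variety :: "('f, 'x) variety \<Rightarrow> ('f, 'a) algebra \<Rightarrow> bool" where
  "in_variety \<Theta> A \<longleftrightarrow> is_algebra (sig \<Theta>) A \<and>
     (\<forall>(l, r) \<in> ids \<Theta>. \<forall>v. (\<forall>x. v x \<in> Carr A) \<longrightarrow> tm_val A v l = tm_val A v r)"

definition Hom :: "('f \<times> nat) set \<Rightarrow> ('f, 'a) algebra \<Rightarrow> ('f, 'b) algebra \<Rightarrow> ('a \<Rightarrow> 'b) set" where
  "Hom \<Omega> A B = {h \<in> Carr A \<rightarrow>\<^sub>E Carr B.
     \<forall>f as. (f, length as) \<in> \<Omega> \<and> set as \<subseteq> Carr A \<longrightarrow> h (Op A f as) = Op B f (map h as)}"


section \<open>The free algebras \<open>W(X)\<close>\<close>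

inductive_set free_cong ::
  "('f, 'x) variety \<Rightarrow> 'x set \<Rightarrow> (('f, 'x) tm \<times> ('f, 'x) tm) set"
  for \<Theta> :: "('f, 'x) variety" and X :: "'x set" where
  inst: "(l, r) \<in> ids \<Theta> \<Longrightarrow> (\<And>x. \<sigma> x \<in> terms (sig \<Theta>) X) \<Longrightarrow>
           (subst \<sigma> l, subst \<sigma> r) \<in> free_cong \<Theta> X"
| refl: "t \<in> terms (sig \<Theta>) X \<Longrightarrow> (t, t) \<in> free_cong \<Theta> X"
| sym: "(t, u) \<in> free_cong \<Theta> X \<Longrightarrow> (u, t) \<in> free_cong \<Theta> X"
| trans: "(t, u) \<in> free_cong \<Theta> X \<Longrightarrow> (u, v) \<in> free_cong \<Theta> X \<Longrightarrow> (t, v) \<in> free_cong \<Theta> X"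
| cong: "(f, length ts) \<in> sig \<Theta> \<Longrightarrow> length us = length ts \<Longrightarrow>
           (\<And>i. i < length ts \<Longrightarrow> (ts ! i, us ! i) \<in> free_cong \<Theta> X) \<Longrightarrow>
           (App f ts, App f us) \<in> free_cong \<Theta> X"

definition W :: "('f, 'x) variety \<Rightarrow> 'x set \<Rightarrow> ('f, ('f, 'x) tm set) algebra" where
  "W \<Theta> X = \<lparr> Carr = terms (sig \<Theta>) X // free_cong \<Theta> X,
      Op = (\<lambda>f cs. {t. \<exists>ts. list_all2 (\<in>) ts cs \<and> (App f ts, t) \<in> free_cong \<Theta> X}) \<rparr>"

definition gen :: "('f, 'x) variety \<Rightarrow> 'x set \<Rightarrow> 'x \<Rightarrow> ('f, 'x) tm set" where
  "gen \<Theta> X x = free_cong \<Theta> X `` {Var x}"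

text \<open>\<open>w \<in> W(Y)\<close> does not have \<open>y\<close> in its support: it is represented by a term without \<open>y\<close>.\<close>

definition off_support :: "('f, 'x) variety \<Rightarrow> 'x set \<Rightarrow> 'x \<Rightarrow> ('f, 'x) tm set \<Rightarrow> bool" where
  "off_support \<Theta> Y y w \<longleftrightarrow> (\<exists>t \<in> terms (sig \<Theta>) (Y - {y}). w = free_cong \<Theta> Y `` {t})"

abbreviation HomW ::
  "('f, 'x) variety \<Rightarrow> 'x set \<Rightarrow> 'x set \<Rightarrow> (('f, 'x) tm set \<Rightarrow> ('f, 'x) tm set) set" where
  "HomW \<Theta> X Y \<equiv> Hom (sig \<Theta>) (W \<Theta> X) (W \<Theta> Y)"

abbreviation Points ::
  "('f, 'x) variety \<Rightarrow> 'x set \<Rightarrow> ('f, 'h) algebra \<Rightarrow> (('f, 'x) tm set \<Rightarrow> 'h) set" where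
  "Points \<Theta> X H \<equiv> Hom (sig \<Theta>) (W \<Theta> X) H"


section \<open>Extended Boolean algebras\<close>

record ('x, 'w, 'b) extba =
  carr :: "'b set"
  zero :: 'b
  one :: 'b
  meet :: "'b \<Rightarrow> 'b \<Rightarrow> 'b"
  join :: "'b \<Rightarrow> 'b \<Rightarrow> 'b"
  neg :: "'b \<Rightarrow> 'b"
  ex :: "'x \<Rightarrow> 'b \<Rightarrow> 'b"
  equ :: "'w \<Rightarrow> 'w \<Rightarrow> 'b"

definition le :: "('x, 'w, 'b) extba \<Rightarrow> 'b \<Rightarrow> 'b \<Rightarrow> bool" where
  "le B a b \<longleftrightarrow> meet B a b = a"

definition closed_extba :: "'x set \<Rightarrow> 'w set \<Rightarrow> ('x, 'w, 'b) extba \<Rightarrow> bool" where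
  "closed_extba X V B \<longleftrightarrow>
     zero B \<in> carr B \<and> one B \<in> carr B \<and>
     (\<forall>a \<in> carr B. neg B a \<in> carr B) \<and>
     (\<forall>a \<in> carr B. \<forall>b \<in> carr B. meet B a b \<in> carr B \<and> join B a b \<in> carr B) \<and>
     (\<forall>x \<in> X. \<forall>a \<in> carr B. ex B x a \<in> carr B) \<and>
     (\<forall>w \<in> V. \<forall>w' \<in> V. equ B w w' \<in> carr B)"

text \<open>Huntington's axioms. The one-element Boolean algebra is admitted.\<close>

definition boolean_axioms :: "('x, 'w, 'b) extba \<Rightarrow> bool" where
  "boolean_axioms B \<longleftrightarrow>
     (\<forall>a \<in> carr B. \<forall>b \<in> carr B.
        meet B a b = meet B b a \<and> join B a b = join B b a) \<and>
     (\<forall>a \<in> carr B. \<forall>b \<in> carr B. \<forall>c \<in> carr B.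
        meet B a (join B b c) = join B (meet B a b) (meet B a c) \<and>
        join B a (meet B b c) = meet B (join B a b) (join B a c)) \<and>
     (\<forall>a \<in> carr B. meet B a (one B) = a \<and> join B a (zero B) = a) \<and>
     (\<forall>a \<in> carr B. meet B a (neg B a) = zero B \<and> join B a (neg B a) = one B)"

definition quantifier_axioms :: "'x set \<Rightarrow> ('x, 'w, 'b) extba \<Rightarrow> bool" where
  "quantifier_axioms X B \<longleftrightarrow>
     (\<forall>x \<in> X. ex B x (zero B) = zero B) \<and>
     (\<forall>x \<in> X. \<forall>a \<in> carr B. le B a (ex B x a)) \<and>
     (\<forall>x \<in> X. \<forall>a \<in> carr B. \<forall>b \<in> carr B.
        ex B x (meet B a (ex B x b)) = meet B (ex B x a) (ex B x b)) \<and>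
     (\<forall>x \<in> X. \<forall>y \<in> X. \<forall>a \<in> carr B. ex B x (ex B y a) = ex B y (ex B x a))"

text \<open>The last clause is
  \<open>w\<^sub>1 \<equiv> w'\<^sub>1 \<and> \<dots> \<and> w\<^sub>n \<equiv> w'\<^sub>n \<le> f(w\<^sub>1,\<dots>,w\<^sub>n) \<equiv> f(w'\<^sub>1,\<dots>,w'\<^sub>n)\<close>.
  Symmetry and transitivity are sometimes omitted from the axioms, since in a Halmos algebra they
  follow from the interaction of the equalities with \<open>s\<^sub>*\<close>.\<close>

definition equality_axioms ::
  "('f \<times> nat) set \<Rightarrow> ('f, 'w) algebra \<Rightarrow> ('x, 'w, 'b) extba \<Rightarrow> bool" where
  "equality_axioms \<Omega> A B \<longleftrightarrow>
     (\<forall>w \<in> Carr A. equ B w w = one B) \<and>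
     (\<forall>w \<in> Carr A. \<forall>w' \<in> Carr A. le B (equ B w w') (equ B w' w)) \<and>
     (\<forall>w \<in> Carr A. \<forall>w' \<in> Carr A. \<forall>w'' \<in> Carr A.
        le B (meet B (equ B w w') (equ B w' w'')) (equ B w w'')) \<and>
     (\<forall>f ws ws'. (f, length ws) \<in> \<Omega> \<and> length ws' = length ws \<and>
        set ws \<subseteq> Carr A \<and> set ws' \<subseteq> Carr A \<longrightarrow>
        le B (foldr (meet B) (map2 (equ B) ws ws') (one B)) (equ B (Op A f ws) (Op A f ws')))"

definition extended_boolean_algebra ::
  "('f, 'x) variety \<Rightarrow> 'x set \<Rightarrow> ('x, ('f, 'x) tm set, 'b) extba \<Rightarrow> bool" where
  "extended_boolean_algebra \<Theta> X B \<longleftrightarrow>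
     closed_extba X (Carr (W \<Theta> X)) B \<and> boolean_axioms B \<and> quantifier_axioms X B \<and>
     equality_axioms (sig \<Theta>) (W \<Theta> X) B"

definition boolean_hom ::
  "('x, 'w, 'b) extba \<Rightarrow> ('x, 'w, 'c) extba \<Rightarrow> ('b \<Rightarrow> 'c) \<Rightarrow> bool" where
  "boolean_hom B C h \<longleftrightarrow>
     h \<in> carr B \<rightarrow> carr C \<and>
     h (zero B) = zero C \<and> h (one B) = one C \<and>
     (\<forall>a \<in> carr B. h (neg B a) = neg C (h a)) \<and>
     (\<forall>a \<in> carr B. \<forall>b \<in> carr B.
        h (meet B a b) = meet C (h a) (h b) \<and> h (join B a b) = join C (h a) (h b))"

definition extba_hom ::
  "'x set \<Rightarrow> 'w set \<Rightarrow> ('x, 'w, 'b) extba \<Rightarrow> ('x, 'w, 'c) extba \<Rightarrow> ('b \<Rightarrow> 'c) \<Rightarrow> bool" where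
  "extba_hom X V B C h \<longleftrightarrow> boolean_hom B C h \<and>
     (\<forall>x \<in> X. \<forall>a \<in> carr B. h (ex B x a) = ex C x (h a)) \<and>
     (\<forall>w \<in> V. \<forall>w' \<in> V. h (equ B w w') = equ C w w')"


section \<open>Halmos algebras\<close>

text \<open>The sorts are the finite sets \<open>X\<close> of variables, i.e. the elements of \<open>\<Gamma>\<close>; nothing is required
  of \<open>srt K X\<close> for infinite \<open>X\<close>. \<open>sub K X Y s\<close> is the operation \<open>s\<^sub>*\<close> for \<open>s : W(X) \<rightarrow> W(Y)\<close>.\<close>

record ('x, 'w, 'b) halmos =
  srt :: "'x set \<Rightarrow> ('x, 'w, 'b) extba"
  sub :: "'x set \<Rightarrow> 'x set \<Rightarrow> ('w \<Rightarrow> 'w) \<Rightarrow> 'b \<Rightarrow> 'b"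

text \<open>\<open>s\<close> is the endomorphism of \<open>W(X)\<close> sending \<open>x\<close> to \<open>w\<close> and fixing the other variables.\<close>

definition replaces ::
  "('f, 'x) variety \<Rightarrow> 'x set \<Rightarrow> 'x \<Rightarrow> ('f, 'x) tm set \<Rightarrow>
     (('f, 'x) tm set \<Rightarrow> ('f, 'x) tm set) \<Rightarrow> bool" where
  "replaces \<Theta> X x w s \<longleftrightarrow> s \<in> HomW \<Theta> X X \<and> s (gen \<Theta> X x) = w \<and>
     (\<forall>x' \<in> X - {x}. s (gen \<Theta> X x') = gen \<Theta> X x')"

text \<open>The operations \<open>s\<^sub>*\<close> are covariant in \<open>s\<close>. The two quantifier clauses are: \<open>s\<^sub>* \<exists>x a = s'\<^sub>* \<exists>x a\<close>
  if \<open>s\<close> and \<open>s'\<close> agree on \<open>X - {x}\<close>; and \<open>s\<^sub>* \<exists>x a = \<exists>y s\<^sub>* a\<close> if \<open>s x = y\<close> is a variable outside the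
  supports of all \<open>s x'\<close>, \<open>x' \<noteq> x\<close>. The last clause is \<open>s\<^sub>* a \<and> (w \<equiv> w') \<le> s'\<^sub>* a\<close>, where \<open>s\<close> and \<open>s'\<close>
  replace \<open>x\<close> by \<open>w\<close> and by \<open>w'\<close>.\<close>

definition halmos_algebra ::
  "('f, 'x) variety \<Rightarrow> ('x, ('f, 'x) tm set, 'b) halmos \<Rightarrow> bool" where
  "halmos_algebra \<Theta> K \<longleftrightarrow>
     (\<forall>X. finite X \<longrightarrow> extended_boolean_algebra \<Theta> X (srt K X)) \<and>
     (\<forall>X Y s. finite X \<and> finite Y \<and> s \<in> HomW \<Theta> X Y \<longrightarrow>
        boolean_hom (srt K X) (srt K Y) (sub K X Y s)) \<and>
     (\<forall>X. \<forall>a \<in> carr (srt K X). finite X \<longrightarrow>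
        sub K X X (restrict id (Carr (W \<Theta> X))) a = a) \<and>
     (\<forall>X Y Z s t. \<forall>a \<in> carr (srt K X).
        finite X \<and> finite Y \<and> finite Z \<and> s \<in> HomW \<Theta> X Y \<and> t \<in> HomW \<Theta> Y Z \<longrightarrow>
        sub K X Z (compose (Carr (W \<Theta> X)) t s) a = sub K Y Z t (sub K X Y s a)) \<and>
     (\<forall>X Y s s' x. \<forall>a \<in> carr (srt K X).
        finite X \<and> finite Y \<and> s \<in> HomW \<Theta> X Y \<and> s' \<in> HomW \<Theta> X Y \<and> x \<in> X \<and>
        (\<forall>x' \<in> X - {x}. s (gen \<Theta> X x') = s' (gen \<Theta> X x')) \<longrightarrow>
        sub K X Y s (ex (srt K X) x a) = sub K X Y s' (ex (srt K X) x a)) \<and>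
     (\<forall>X Y s x y. \<forall>a \<in> carr (srt K X).
        finite X \<and> finite Y \<and> s \<in> HomW \<Theta> X Y \<and> x \<in> X \<and> y \<in> Y \<and>
        s (gen \<Theta> X x) = gen \<Theta> Y y \<and>
        (\<forall>x' \<in> X - {x}. off_support \<Theta> Y y (s (gen \<Theta> X x'))) \<longrightarrow>
        sub K X Y s (ex (srt K X) x a) = ex (srt K Y) y (sub K X Y s a)) \<and>
     (\<forall>X Y s. \<forall>w \<in> Carr (W \<Theta> X). \<forall>w' \<in> Carr (W \<Theta> X).
        finite X \<and> finite Y \<and> s \<in> HomW \<Theta> X Y \<longrightarrow>
        sub K X Y s (equ (srt K X) w w') = equ (srt K Y) (s w) (s w')) \<and>
     (\<forall>X x s s'. \<forall>w \<in> Carr (W \<Theta> X). \<forall>w' \<in> Carr (W \<Theta> X). \<forall>a \<in> carr (srt K X).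
        finite X \<and> x \<in> X \<and> replaces \<Theta> X x w s \<and> replaces \<Theta> X x w' s' \<longrightarrow>
        le (srt K X) (meet (srt K X) (sub K X X s a) (equ (srt K X) w w')) (sub K X X s' a))"

definition halmos_hom ::
  "('f, 'x) variety \<Rightarrow> ('x, ('f, 'x) tm set, 'b) halmos \<Rightarrow> ('x, ('f, 'x) tm set, 'c) halmos \<Rightarrow>
     ('x set \<Rightarrow> 'b \<Rightarrow> 'c) \<Rightarrow> bool" where
  "halmos_hom \<Theta> K L h \<longleftrightarrow>
     (\<forall>X. finite X \<longrightarrow> extba_hom X (Carr (W \<Theta> X)) (srt K X) (srt L X) (h X)) \<and>
     (\<forall>X Y s. \<forall>a \<in> carr (srt K X). finite X \<and> finite Y \<and> s \<in> HomW \<Theta> X Y \<longrightarrow>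
        h Y (sub K X Y s a) = sub L X Y s (h X a))"

text \<open>Homomorphisms as set-theoretic functions, i.e. undefined outside the sorts and carriers.\<close>

definition Halmos_Hom ::
  "('f, 'x) variety \<Rightarrow> ('x, ('f, 'x) tm set, 'b) halmos \<Rightarrow> ('x, ('f, 'x) tm set, 'c) halmos \<Rightarrow>
     ('x set \<Rightarrow> 'b \<Rightarrow> 'c) set" where
  "Halmos_Hom \<Theta> K L =
     {h \<in> (\<Pi>\<^sub>E X \<in> {X. finite X}. carr (srt K X) \<rightarrow>\<^sub>E carr (srt L X)). halmos_hom \<Theta> K L h}"


section \<open>The Halmos algebra of an algebra \<open>H\<close>\<close>

definition Hal :: "('f, 'x) variety \<Rightarrow> ('f, 'h) algebra \<Rightarrow>
    ('x, ('f, 'x) tm set, (('f, 'x) tm set \<Rightarrow> 'h) set) halmos" where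
  "Hal \<Theta> H = \<lparr>
     srt = (\<lambda>X. \<lparr>
       carr = Pow (Points \<Theta> X H),
       zero = {},
       one = Points \<Theta> X H,
       meet = (\<inter>),
       join = (\<union>),
       neg = (\<lambda>A. Points \<Theta> X H - A),
       ex = (\<lambda>x A. {\<mu> \<in> Points \<Theta> X H.
               \<exists>\<nu> \<in> A. \<forall>x' \<in> X - {x}. \<nu> (gen \<Theta> X x') = \<mu> (gen \<Theta> X x')}),
       equ = (\<lambda>w w'. {\<mu> \<in> Points \<Theta> X H. \<mu> w = \<mu> w'}) \<rparr>),
     sub = (\<lambda>X Y s A. {\<mu> \<in> Points \<Theta> Y H. compose (Carr (W \<Theta> X)) \<mu> s \<in> A}) \<rparr>"


section \<open>The algebra of formulas\<close>

text \<open>\<open>\<Phi>\<close> is constructed in the standard way: the absolutely free multi-sorted algebra over the formal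
  equalities, modulo the least congruence with a Halmos algebra as quotient. The formal equalities
  \<open>w \<equiv> w'\<close> are the equality constants of the signature. \<open>FSub X s u\<close> is the formal application of
  \<open>s\<^sub>*\<close> to a formula of sort \<open>X\<close>.\<close>

datatype ('x, 'w) fm =
    FEq 'w 'w
  | FZero
  | FOne
  | FNeg "('x, 'w) fm"
  | FMeet "('x, 'w) fm" "('x, 'w) fm"
  | FJoin "('x, 'w) fm" "('x, 'w) fm"
  | FEx 'x "('x, 'w) fm"
  | FSub "'x set" "'w \<Rightarrow> 'w" "('x, 'w) fm"

inductive fm_sort :: "('f, 'x) variety \<Rightarrow> 'x set \<Rightarrow> ('x, ('f, 'x) tm set) fm \<Rightarrow> bool"
  for \<Theta> :: "('f, 'x) variety" where
  "w \<in> Carr (W \<Theta> X) \<Longrightarrow> w' \<in> Carr (W \<Theta> X) \<Longrightarrow> fm_sort \<Theta> X (FEq w w')"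
| "fm_sort \<Theta> X FZero"
| "fm_sort \<Theta> X FOne"
| "fm_sort \<Theta> X u \<Longrightarrow> fm_sort \<Theta> X (FNeg u)"
| "fm_sort \<Theta> X u \<Longrightarrow> fm_sort \<Theta> X v \<Longrightarrow> fm_sort \<Theta> X (FMeet u v)"
| "fm_sort \<Theta> X u \<Longrightarrow> fm_sort \<Theta> X v \<Longrightarrow> fm_sort \<Theta> X (FJoin u v)"
| "x \<in> X \<Longrightarrow> fm_sort \<Theta> X u \<Longrightarrow> fm_sort \<Theta> X (FEx x u)"
| "finite X \<Longrightarrow> finite Y \<Longrightarrow> s \<in> HomW \<Theta> X Y \<Longrightarrow> fm_sort \<Theta> X u \<Longrightarrow> fm_sort \<Theta> Y (FSub X s u)"

definition abs_free ::
  "('f, 'x) variety \<Rightarrow> ('x, ('f, 'x) tm set, ('x, ('f, 'x) tm set) fm) halmos" where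
  "abs_free \<Theta> = \<lparr>
     srt = (\<lambda>X. \<lparr> carr = {u. fm_sort \<Theta> X u}, zero = FZero, one = FOne, meet = FMeet,
                 join = FJoin, neg = FNeg, ex = FEx, equ = FEq \<rparr>),
     sub = (\<lambda>X Y s u. FSub X s u) \<rparr>"

definition congruence ::
  "('f, 'x) variety \<Rightarrow> ('x, ('f, 'x) tm set, 'b) halmos \<Rightarrow> ('x set \<Rightarrow> ('b \<times> 'b) set) \<Rightarrow> bool" where
  "congruence \<Theta> K \<theta> \<longleftrightarrow>
     (\<forall>X. finite X \<longrightarrow>
        equiv (carr (srt K X)) (\<theta> X) \<and>
        (\<forall>(a, a') \<in> \<theta> X. (neg (srt K X) a, neg (srt K X) a') \<in> \<theta> X) \<and>
        (\<forall>(a, a') \<in> \<theta> X. \<forall>(b, b') \<in> \<theta> X.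
           (meet (srt K X) a b, meet (srt K X) a' b') \<in> \<theta> X \<and>
           (join (srt K X) a b, join (srt K X) a' b') \<in> \<theta> X) \<and>
        (\<forall>x \<in> X. \<forall>(a, a') \<in> \<theta> X. (ex (srt K X) x a, ex (srt K X) x a') \<in> \<theta> X)) \<and>
     (\<forall>X Y s. \<forall>(a, a') \<in> \<theta> X. finite X \<and> finite Y \<and> s \<in> HomW \<Theta> X Y \<longrightarrow>
        (sub K X Y s a, sub K X Y s a') \<in> \<theta> Y)"

text \<open>The operations on classes are read off from arbitrary representatives.\<close>

definition quot ::
  "('x, 'w, 'b) halmos \<Rightarrow> ('x set \<Rightarrow> ('b \<times> 'b) set) \<Rightarrow> ('x, 'w, 'b set) halmos" where
  "quot K \<theta> = \<lparr>
     srt = (\<lambda>X. \<lparr>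
       carr = carr (srt K X) // \<theta> X,
       zero = \<theta> X `` {zero (srt K X)},
       one = \<theta> X `` {one (srt K X)},
       meet = (\<lambda>A B. \<Union>a \<in> A. \<Union>b \<in> B. \<theta> X `` {meet (srt K X) a b}),
       join = (\<lambda>A B. \<Union>a \<in> A. \<Union>b \<in> B. \<theta> X `` {join (srt K X) a b}),
       neg = (\<lambda>A. \<Union>a \<in> A. \<theta> X `` {neg (srt K X) a}),
       ex = (\<lambda>x A. \<Union>a \<in> A. \<theta> X `` {ex (srt K X) x a}),
       equ = (\<lambda>w w'. \<theta> X `` {equ (srt K X) w w'}) \<rparr>),
     sub = (\<lambda>X Y s A. \<Union>a \<in> A. \<theta> Y `` {sub K X Y s a}) \<rparr>"

definition fm_cong ::
  "('f, 'x) variety \<Rightarrow> 'x set \<Rightarrow> (('x, ('f, 'x) tm set) fm \<times> ('x, ('f, 'x) tm set) fm) set" where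
  "fm_cong \<Theta> X =
     \<Inter> {\<theta> X |\<theta>. congruence \<Theta> (abs_free \<Theta>) \<theta> \<and> halmos_algebra \<Theta> (quot (abs_free \<Theta>) \<theta>)}"

definition Phi ::
  "('f, 'x) variety \<Rightarrow> ('x, ('f, 'x) tm set, ('x, ('f, 'x) tm set) fm set) halmos" where
  "Phi \<Theta> = quot (abs_free \<Theta>) (fm_cong \<Theta>)"

abbreviation Formulas ::
  "('f, 'x) variety \<Rightarrow> 'x set \<Rightarrow> ('x, ('f, 'x) tm set) fm set set" where
  "Formulas \<Theta> X \<equiv> carr (srt (Phi \<Theta>) X)"


section \<open>Satisfaction, noetherianity, saturation\<close>

text \<open>Homomorphisms preserve the equality constants, so this is the homomorphism sending
  \<open>w \<equiv> w'\<close> to \<open>{\<mu>. \<mu> w = \<mu> w'}\<close>.\<close>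

definition Val :: "('f, 'x) variety \<Rightarrow> ('f, 'h) algebra \<Rightarrow> 'x set \<Rightarrow>
    ('x, ('f, 'x) tm set) fm set \<Rightarrow> (('f, 'x) tm set \<Rightarrow> 'h) set" where
  "Val \<Theta> H = (THE h. h \<in> Halmos_Hom \<Theta> (Phi \<Theta>) (Hal \<Theta> H))"

definition LKer :: "('f, 'x) variety \<Rightarrow> ('f, 'h) algebra \<Rightarrow> 'x set \<Rightarrow>
    (('f, 'x) tm set \<Rightarrow> 'h) \<Rightarrow> ('x, ('f, 'x) tm set) fm set set" where
  "LKer \<Theta> H X \<mu> = {u \<in> Formulas \<Theta> X. \<mu> \<in> Val \<Theta> H X u}"

definition Th :: "('f, 'x) variety \<Rightarrow> ('f, 'h) algebra \<Rightarrow> 'x set \<Rightarrow>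
    ('x, ('f, 'x) tm set) fm set set" where
  "Th \<Theta> H X = {u \<in> Formulas \<Theta> X. Val \<Theta> H X u = Points \<Theta> X H}"

definition TL :: "('f, 'x) variety \<Rightarrow> ('f, 'h) algebra \<Rightarrow> 'x set \<Rightarrow>
    ('x, ('f, 'x) tm set) fm set set \<Rightarrow> (('f, 'x) tm set \<Rightarrow> 'h) set" where
  "TL \<Theta> H X T = {\<mu> \<in> Points \<Theta> X H. T \<subseteq> LKer \<Theta> H X \<mu>}"

definition logically_noetherian :: "('f, 'x) variety \<Rightarrow> ('f, 'h) algebra \<Rightarrow> bool" where
  "logically_noetherian \<Theta> H \<longleftrightarrow>
     (\<forall>X T. finite X \<and> T \<subseteq> Formulas \<Theta> X \<longrightarrow>
        (\<exists>T0 \<subseteq> T. finite T0 \<and> TL \<Theta> H X T0 = TL \<Theta> H X T))"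

definition proper_filter :: "('x, 'w, 'b) extba \<Rightarrow> 'b set \<Rightarrow> bool" where
  "proper_filter B T \<longleftrightarrow> T \<subseteq> carr B \<and> one B \<in> T \<and> zero B \<notin> T \<and>
     (\<forall>a \<in> T. \<forall>b \<in> T. meet B a b \<in> T) \<and>
     (\<forall>a \<in> T. \<forall>b \<in> carr B. le B a b \<longrightarrow> b \<in> T)"

definition is_ultrafilter :: "('x, 'w, 'b) extba \<Rightarrow> 'b set \<Rightarrow> bool" where
  "is_ultrafilter B T \<longleftrightarrow> proper_filter B T \<and> (\<forall>F. proper_filter B F \<and> T \<subseteq> F \<longrightarrow> F = T)"

definition LG_saturated :: "('f, 'x) variety \<Rightarrow> ('f, 'h) algebra \<Rightarrow> bool" where
  "LG_saturated \<Theta> H \<longleftrightarrow>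
     (\<forall>X T. finite X \<and> is_ultrafilter (srt (Phi \<Theta>) X) T \<and> Th \<Theta> H X \<subseteq> T \<longrightarrow>
        (\<exists>\<mu> \<in> Points \<Theta> X H. T = LKer \<Theta> H X \<mu>))"

end

theory Submission
  imports Defs
begin

text \<open>Let \<open>T\<close> be an ultrafilter of \<open>\<Phi>(X)\<close> containing \<open>Th(H)\<close>, choose a finite \<open>T\<^sub>0 \<subseteq> T\<close> with the
  same points, and let \<open>u \<in> T\<close> be the meet of \<open>T\<^sub>0\<close>. If no point satisfied \<open>u\<close>, then \<open>\<not>u\<close> would lie in
  \<open>Th(H) \<subseteq> T\<close>, contradicting \<open>u \<in> T\<close>. A point \<open>\<mu>\<close> satisfying \<open>u\<close> satisfies all of \<open>T\<close>, so
  \<open>T \<subseteq> LKer(\<mu>)\<close>, and equality holds by maximality of \<open>T\<close>.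

  This uses that \<open>Val\<close> is a homomorphism, i.e. that \<open>\<Phi>\<close> is free and that \<open>Hal(H)\<close> satisfies the
  Halmos axioms. The latter rests on the freeness of \<open>W(X)\<close>: commuting two
  quantifiers, and moving a quantifier past \<open>s\<^sub>*\<close>, require points with prescribed values on \<open>X\<close>.\<close>

section \<open>The algebras \<open>W(X)\<close> are free\<close>

lemma tm_val_cong:
  assumes "t \<in> terms \<Omega> X" and "\<And>x. x \<in> X \<Longrightarrow> v x = v' x"
  shows "tm_val A v t = tm_val A v' t"
  using assms(1)
proof induction
  case (app f ts)
  then have "map (tm_val A v) ts = map (tm_val A v') ts" by simp
  then show ?case by (simp only: tm_val.simps)
qed (simp add: assms(2))

lemma tm_val_closed:
  assumes "is_algebra \<Omega> A" and "t \<in> terms \<Omega> X" and "\<And>x. x \<in> X \<Longrightarrow> v x \<in> Carr A"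
  shows "tm_val A v t \<in> Carr A"
  using assms(2)
proof induction
  case (app f ts)
  then have "set (map (tm_val A v) ts) \<subseteq> Carr A" by auto
  with app assms(1) show ?case
    unfolding is_algebra_def tm_val.simps by (metis length_map)
qed (simp add: assms(3))

lemma tm_val_subst: "tm_val A v (subst \<sigma> t) = tm_val A (\<lambda>x. tm_val A v (\<sigma> x)) t"
  by (induction t) (simp_all add: comp_def cong: map_cong)

lemma subst_terms:
  assumes "t \<in> terms \<Omega> Y" and "\<And>x. x \<in> Y \<Longrightarrow> \<sigma> x \<in> terms \<Omega> X"
  shows "subst \<sigma> t \<in> terms \<Omega> X"
  using assms(1)
proof induction
  case (app f ts)
  then show ?case by (auto intro!: terms.app)
qed (simp add: assms(2))

lemma terms_mono: "t \<in> terms \<Omega> X \<Longrightarrow> X \<subseteq> Y \<Longrightarrow> t \<in> terms \<Omega> Y"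
  by (induction rule: terms.induct) (auto intro: terms.intros)

text \<open>The rule \<open>inst\<close> constrains only the substitution, so this rests on
  \<open>wf_variety\<close>: the identities are terms of the signature, and \<open>\<sigma>\<close>
  carries all variables, also those outside \<open>X\<close>, to terms over
  \<open>X\<close>.\<close>

lemma free_cong_terms:
  assumes "wf_variety \<Theta>" and "(t, u) \<in> free_cong \<Theta> X"
  shows "t \<in> terms (sig \<Theta>) X \<and> u \<in> terms (sig \<Theta>) X"
  using assms(2)
proof induction
  case (inst l r \<sigma>)
  then have "l \<in> terms (sig \<Theta>) UNIV" "r \<in> terms (sig \<Theta>) UNIV"
    using assms(1) unfolding wf_variety_def by auto
  with inst show ?case by (auto intro: subst_terms)
next
  case (cong f ts us)
  then show ?case
    by (auto intro!: terms.app simp: in_set_conv_nth)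
qed auto

lemma equiv_free_cong:
  "wf_variety \<Theta> \<Longrightarrow> equiv (terms (sig \<Theta>) X) (free_cong \<Theta> X)"
  by (auto simp: equiv_def refl_on_def sym_def trans_def
      dest: free_cong_terms intro: free_cong.refl free_cong.sym free_cong.trans)

text \<open>Induction on the derivation. For an instance, substitution followed by evaluation is
  evaluation under the assignment of \<open>tm_val A v (\<sigma> x)\<close> to \<open>x\<close>.
  Since \<open>\<sigma>\<close> has values over \<open>X\<close> at every variable, this assignment
  is total into the carrier, as validity of the identities demands, although \<open>v\<close> is
  controlled on \<open>X\<close> only.\<close>

lemma free_cong_sound:
  assumes "in_variety \<Theta> A" and "(t, u) \<in> free_cong \<Theta> X" and "\<And>x. x \<in> X \<Longrightarrow> v x \<in> Carr A"
  shows "tm_val A v t = tm_val A v u"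
  using assms(2)
proof induction
  case (inst l r \<sigma>)
  have "\<forall>x. tm_val A v (\<sigma> x) \<in> Carr A"
    using inst assms tm_val_closed unfolding in_variety_def by blast
  moreover have "\<forall>v. (\<forall>x. v x \<in> Carr A) \<longrightarrow> tm_val A v l = tm_val A v r"
    using inst(1) assms(1) by (auto simp: in_variety_def)
  ultimately show ?case by (simp add: tm_val_subst)
next
  case (cong f ts us)
  then have "map (tm_val A v) ts = map (tm_val A v) us" by (simp add: list_eq_iff_nth_eq)
  then show ?case by (simp only: tm_val.simps)
qed auto

section \<open>Classes of terms as elements of \<open>W(X)\<close>\<close>

abbreviation cls :: "('f, 'x) variety \<Rightarrow> 'x set \<Rightarrow> ('f, 'x) tm \<Rightarrow> ('f, 'x) tm set" where
  "cls \<Theta> X t \<equiv> free_cong \<Theta> X `` {t}"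

lemma cls_in_W: "t \<in> terms (sig \<Theta>) X \<Longrightarrow> cls \<Theta> X t \<in> Carr (W \<Theta> X)"
  by (simp add: W_def quotientI)

lemma gen_in_W: "x \<in> X \<Longrightarrow> gen \<Theta> X x \<in> Carr (W \<Theta> X)"
  by (simp add: gen_def cls_in_W terms.var)

lemma W_cases:
  assumes "w \<in> Carr (W \<Theta> X)"
  obtains t where "t \<in> terms (sig \<Theta>) X" and "w = cls \<Theta> X t"
  using assms by (auto simp: W_def elim: quotientE)

lemma W_list_cases:
  assumes "set ws \<subseteq> Carr (W \<Theta> X)"
  obtains ts where "set ts \<subseteq> terms (sig \<Theta>) X" and "ws = map (cls \<Theta> X) ts"
proof -
  have "\<exists>ts. set ts \<subseteq> terms (sig \<Theta>) X \<and> ws = map (cls \<Theta> X) ts"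
    using assms
  proof (induction ws)
    case (Cons w ws)
    then obtain ts where ts: "set ts \<subseteq> terms (sig \<Theta>) X" "ws = map (cls \<Theta> X) ts" by auto
    from Cons obtain t where "t \<in> terms (sig \<Theta>) X" "w = cls \<Theta> X t" by (auto elim: W_cases)
    with ts show ?case by (intro exI[of _ "t # ts"]) simp
  qed simp
  with that show ?thesis by blast
qed

text \<open>\<open>Op\<close> of \<open>W\<close> collects the results for all choices of
  representatives. The rule \<open>cong\<close> makes any two choices derivably equal, and
  reflexivity makes \<open>ts\<close> itself one of the choices.\<close>

lemma W_Op:
  assumes "wf_variety \<Theta>" and "(f, length ts) \<in> sig \<Theta>" and "set ts \<subseteq> terms (sig \<Theta>) X"
  shows "Op (W \<Theta> X) f (map (cls \<Theta> X) ts) = cls \<Theta> X (App f ts)"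
proof (intro set_eqI iffI)
  fix u
  assume "u \<in> Op (W \<Theta> X) f (map (cls \<Theta> X) ts)"
  then obtain us where "list_all2 (\<in>) us (map (cls \<Theta> X) ts)" and u: "(App f us, u) \<in> free_cong \<Theta> X"
    by (auto simp: W_def)
  then have "(App f ts, App f us) \<in> free_cong \<Theta> X"
    using assms(2) by (intro free_cong.cong) (auto simp: list_all2_conv_all_nth)
  with u show "u \<in> cls \<Theta> X (App f ts)" by (auto intro: free_cong.trans)
next
  fix u
  assume u: "u \<in> cls \<Theta> X (App f ts)"
  have "list_all2 (\<in>) ts (map (cls \<Theta> X) ts)"
    using assms(3) by (auto simp: list_all2_conv_all_nth intro!: free_cong.refl)
  with u show "u \<in> Op (W \<Theta> X) f (map (cls \<Theta> X) ts)" by (auto simp: W_def)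
qed

lemma is_algebra_W:
  assumes "wf_variety \<Theta>"
  shows "is_algebra (sig \<Theta>) (W \<Theta> X)"
  unfolding is_algebra_def
proof (intro allI impI, elim conjE)
  fix f ws
  assume f: "(f, length ws) \<in> sig \<Theta>" and "set ws \<subseteq> Carr (W \<Theta> X)"
  then obtain ts where ts: "set ts \<subseteq> terms (sig \<Theta>) X" "ws = map (cls \<Theta> X) ts"
    by (auto elim: W_list_cases)
  with f have "App f ts \<in> terms (sig \<Theta>) X" by (auto intro: terms.app)
  with W_Op[OF assms _ ts(1)] f ts show "Op (W \<Theta> X) f ws \<in> Carr (W \<Theta> X)"
    by (simp add: cls_in_W)
qed

section \<open>Homomorphisms, in particular those out of \<open>W(X)\<close>\<close>

lemma Hom_closed: "h \<in> Hom \<Omega> A B \<Longrightarrow> a \<in> Carr A \<Longrightarrow> h a \<in> Carr B"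
  by (auto simp: Hom_def)

lemma Hom_Op:
  "h \<in> Hom \<Omega> A B \<Longrightarrow> (f, length as) \<in> \<Omega> \<Longrightarrow> set as \<subseteq> Carr A \<Longrightarrow> h (Op A f as) = Op B f (map h as)"
  by (auto simp: Hom_def)

lemma Hom_extensional: "h \<in> Hom \<Omega> A B \<Longrightarrow> h \<in> extensional (Carr A)"
  by (auto simp: Hom_def PiE_def)

lemma Hom_compose:
  assumes "is_algebra \<Omega> A" and g: "g \<in> Hom \<Omega> A B" and h: "h \<in> Hom \<Omega> B C"
  shows "compose (Carr A) h g \<in> Hom \<Omega> A C"
proof -
  have "compose (Carr A) h g (Op A f as) = Op C f (map (compose (Carr A) h g) as)"
    if f: "(f, length as) \<in> \<Omega>" and as: "set as \<subseteq> Carr A" for f as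
  proof -
    have "Op A f as \<in> Carr A" using assms(1) f as by (auto simp: is_algebra_def)
    moreover have "map (compose (Carr A) h g) as = map h (map g as)"
      using as by (auto simp: compose_eq)
    moreover have "set (map g as) \<subseteq> Carr B" using as g by (auto intro: Hom_closed)
    ultimately show ?thesis
      using Hom_Op[OF g f as] Hom_Op[OF h, of f "map g as"] f
      by (simp add: compose_eq del: map_map map_eq_conv)
  qed
  moreover have "compose (Carr A) h g \<in> Carr A \<rightarrow>\<^sub>E Carr C"
    using g h by (auto simp: compose_def Hom_closed)
  ultimately show ?thesis by (simp add: Hom_def)
qed

lemma Hom_restrict_id: "is_algebra \<Omega> A \<Longrightarrow> restrict id (Carr A) \<in> Hom \<Omega> A A"
  by (auto simp: Hom_def is_algebra_def intro!: arg_cong[where f = "Op A _"] map_idI[symmetric])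

text \<open>By induction on the term, a homomorphism out of \<open>W(X)\<close> is evaluation at its
  values on the generators. The next two facts reduce to this.\<close>

lemma Hom_cls:
  assumes "wf_variety \<Theta>" and h: "h \<in> Hom (sig \<Theta>) (W \<Theta> X) A" and "t \<in> terms (sig \<Theta>) X"
  shows "h (cls \<Theta> X t) = tm_val A (\<lambda>x. h (gen \<Theta> X x)) t"
  using assms(3)
proof induction
  case (app f ts)
  then have ts: "set ts \<subseteq> terms (sig \<Theta>) X" by auto
  then have "set (map (cls \<Theta> X) ts) \<subseteq> Carr (W \<Theta> X)" by (auto intro: cls_in_W)
  then have "h (cls \<Theta> X (App f ts)) = Op A f (map h (map (cls \<Theta> X) ts))"
    using Hom_Op[OF h] W_Op[OF assms(1) app(1) ts] app(1) by (metis length_map)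
  moreover have "map h (map (cls \<Theta> X) ts) = map (tm_val A (\<lambda>x. h (gen \<Theta> X x))) ts"
    using app.IH by simp
  ultimately show ?case by (simp only: tm_val.simps)
qed (simp add: gen_def)

text \<open>The generators determine all values on the carrier, and extensionality settles the
  arguments outside it.\<close>

lemma Hom_W_eqI:
  assumes "wf_variety \<Theta>" and h: "h \<in> Hom (sig \<Theta>) (W \<Theta> X) A" and h': "h' \<in> Hom (sig \<Theta>) (W \<Theta> X) A"
    and "\<And>x. x \<in> X \<Longrightarrow> h (gen \<Theta> X x) = h' (gen \<Theta> X x)"
  shows "h = h'"
proof (rule extensionalityI)
  fix w assume "w \<in> Carr (W \<Theta> X)"
  then obtain t where t: "t \<in> terms (sig \<Theta>) X" "w = cls \<Theta> X t" by (rule W_cases)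
  have "tm_val A (\<lambda>x. h (gen \<Theta> X x)) t = tm_val A (\<lambda>x. h' (gen \<Theta> X x)) t"
    using t(1) assms(4) by (rule tm_val_cong)
  then show "h w = h' w"
    by (simp add: Hom_cls[OF assms(1) h t(1)] Hom_cls[OF assms(1) h' t(1)] t(2))
qed (use Hom_extensional[OF h] Hom_extensional[OF h'] in auto)

text \<open>A representative that avoids \<open>x\<close> is evaluated without reading the generator
  of \<open>x\<close>. The support condition of the quantifier axioms enters through this
  fact.\<close>

lemma Hom_W_eq_off_support:
  assumes "wf_variety \<Theta>" and h: "h \<in> Hom (sig \<Theta>) (W \<Theta> X) A" and h': "h' \<in> Hom (sig \<Theta>) (W \<Theta> X) A"
    and "\<And>x'. x' \<in> X - {x} \<Longrightarrow> h (gen \<Theta> X x') = h' (gen \<Theta> X x')"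
    and "off_support \<Theta> X x w"
  shows "h w = h' w"
proof -
  obtain t where t: "t \<in> terms (sig \<Theta>) (X - {x})" "w = cls \<Theta> X t"
    using assms(5) by (auto simp: off_support_def)
  then have t': "t \<in> terms (sig \<Theta>) X" by (auto intro: terms_mono)
  have "tm_val A (\<lambda>x. h (gen \<Theta> X x)) t = tm_val A (\<lambda>x. h' (gen \<Theta> X x)) t"
    using t(1) assms(4) by (rule tm_val_cong)
  then show ?thesis
    by (simp add: Hom_cls[OF assms(1) h t'] Hom_cls[OF assms(1) h' t'] t(2))
qed

text \<open>The existence half of the universal property: evaluate any term of the class; by
  soundness the choice is immaterial, since \<open>A\<close> satisfies the identities.\<close>

lemma Hom_W_extend:
  assumes wf: "wf_variety \<Theta>" and A: "in_variety \<Theta> A" and v: "\<And>x. x \<in> X \<Longrightarrow> v x \<in> Carr A"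
  obtains h where "h \<in> Hom (sig \<Theta>) (W \<Theta> X) A" and "\<And>x. x \<in> X \<Longrightarrow> h (gen \<Theta> X x) = v x"
proof -
  have alg: "is_algebra (sig \<Theta>) A" using A by (simp add: in_variety_def)
  define h where "h = restrict (\<lambda>w. tm_val A v (SOME t. t \<in> w)) (Carr (W \<Theta> X))"
  have h: "h (cls \<Theta> X t) = tm_val A v t" if t: "t \<in> terms (sig \<Theta>) X" for t
  proof -
    have "t \<in> cls \<Theta> X t" using t by (auto intro: free_cong.refl)
    then have "(SOME t'. t' \<in> cls \<Theta> X t) \<in> cls \<Theta> X t" by (rule someI)
    then show ?thesis
      using free_cong_sound[where v = v, OF A _ v] t by (auto simp: h_def cls_in_W)
  qed
  have "h w \<in> Carr A" if "w \<in> Carr (W \<Theta> X)" for w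
    using that by (rule W_cases) (use h tm_val_closed[OF alg _ v] in simp)
  moreover have "h (Op (W \<Theta> X) f ws) = Op A f (map h ws)"
    if f: "(f, length ws) \<in> sig \<Theta>" and ws: "set ws \<subseteq> Carr (W \<Theta> X)" for f ws
  proof -
    obtain ts where ts: "set ts \<subseteq> terms (sig \<Theta>) X" "ws = map (cls \<Theta> X) ts"
      using ws by (rule W_list_cases)
    then have "App f ts \<in> terms (sig \<Theta>) X" using f by (auto intro: terms.app)
    moreover have "map h ws = map (tm_val A v) ts" using ts h by auto
    ultimately show ?thesis
      using W_Op[OF wf _ ts(1), of f] f ts(2) h by (simp del: map_map map_eq_conv)
  qed
  ultimately have "h \<in> Hom (sig \<Theta>) (W \<Theta> X) A" by (auto simp: Hom_def h_def)
  moreover have "h (gen \<Theta> X x) = v x" if "x \<in> X" for x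
    using that h[of "Var x"] by (simp add: gen_def terms.var)
  ultimately show ?thesis using that by blast
qed

section \<open>\<open>Hal(H)\<close> is a Halmos algebra\<close>

lemma ex_Hal:
  "\<mu> \<in> ex (srt (Hal \<Theta> H) X) x A \<longleftrightarrow> \<mu> \<in> Points \<Theta> X H \<and>
    (\<exists>\<nu> \<in> A. \<forall>x' \<in> X - {x}. \<nu> (gen \<Theta> X x') = \<mu> (gen \<Theta> X x'))"
  by (simp add: Hal_def)

lemma sub_Hal:
  "\<mu> \<in> sub (Hal \<Theta> H) X Y s A \<longleftrightarrow> \<mu> \<in> Points \<Theta> Y H \<and> compose (Carr (W \<Theta> X)) \<mu> s \<in> A"
  by (simp add: Hal_def)

text \<open>One inclusion suffices, since interchanging \<open>x\<close> and \<open>y\<close> gives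
  the other.\<close>

lemma ex_Hal_commute:
  assumes "wf_variety \<Theta>" and "in_variety \<Theta> H"
    and "x \<in> X" and "y \<in> X" and "A \<subseteq> Points \<Theta> X H"
  shows "ex (srt (Hal \<Theta> H) X) x (ex (srt (Hal \<Theta> H) X) y A)
    \<subseteq> ex (srt (Hal \<Theta> H) X) y (ex (srt (Hal \<Theta> H) X) x A)"
proof
  fix \<mu>
  assume "\<mu> \<in> ex (srt (Hal \<Theta> H) X) x (ex (srt (Hal \<Theta> H) X) y A)"
  then obtain \<nu> \<rho> where \<mu>: "\<mu> \<in> Points \<Theta> X H" and \<rho>: "\<rho> \<in> A"
    and \<nu>\<mu>: "\<forall>z \<in> X - {x}. \<nu> (gen \<Theta> X z) = \<mu> (gen \<Theta> X z)"
    and \<rho>\<nu>: "\<forall>z \<in> X - {y}. \<rho> (gen \<Theta> X z) = \<nu> (gen \<Theta> X z)"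
    by (auto simp: Hal_def)
  have "\<rho> \<in> Points \<Theta> X H" using \<rho> assms(5) by auto
  \<comment> \<open>The intermediate point for the other order takes its value at \<open>y\<close>
    from \<open>\<rho>\<close> and all other values from \<open>\<mu>\<close>. It agrees with
    \<open>\<mu>\<close> off \<open>y\<close>, and with \<open>\<rho>\<close> off \<open>x\<close>,
    because \<open>\<rho>\<close>, \<open>\<nu>\<close> and \<open>\<mu>\<close> coincide off
    \<open>x\<close> and \<open>y\<close>.\<close>
  then have "(if z = y then \<rho> (gen \<Theta> X y) else \<mu> (gen \<Theta> X z)) \<in> Carr H" if "z \<in> X" for z
    using that \<mu> by (auto intro: Hom_closed gen_in_W)
  then obtain \<nu>' where \<nu>': "\<nu>' \<in> Points \<Theta> X H"
    "\<And>z. z \<in> X \<Longrightarrow> \<nu>' (gen \<Theta> X z) = (if z = y then \<rho> (gen \<Theta> X y) else \<mu> (gen \<Theta> X z))"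
    by (rule Hom_W_extend[OF assms(1,2), of X
          "\<lambda>z. if z = y then \<rho> (gen \<Theta> X y) else \<mu> (gen \<Theta> X z)"])
        (assumption, rule that)
  then have "\<nu>' \<in> ex (srt (Hal \<Theta> H) X) x A"
    using \<rho> \<nu>\<mu> \<rho>\<nu> unfolding ex_Hal by (auto intro!: bexI[of _ \<rho>])
  with \<nu>'(2) \<mu> show "\<mu> \<in> ex (srt (Hal \<Theta> H) X) y (ex (srt (Hal \<Theta> H) X) x A)"
    unfolding ex_Hal[of _ _ _ _ y] by (intro conjI bexI[of _ \<nu>']) auto
qed

lemma equality_axioms_Hal: "equality_axioms (sig \<Theta>) (W \<Theta> X) (srt (Hal \<Theta> H) X)"
proof -
  \<comment> \<open>The conjunction of the equalities is the set of points that agree on the two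
    lists entrywise; for such points the congruence clause is preservation of
    \<open>Op\<close>.\<close>
  have foldr: "foldr (\<inter>) (map2 (\<lambda>w w'. {\<mu> \<in> Points \<Theta> X H. \<mu> w = \<mu> w'}) ws ws') (Points \<Theta> X H)
      = {\<mu> \<in> Points \<Theta> X H. map \<mu> ws = map \<mu> ws'}" if "length ws' = length ws" for ws ws'
    using that[symmetric] by (induction ws ws' rule: list_induct2) auto
  show ?thesis
    unfolding equality_axioms_def le_def
    by (auto simp: Hal_def foldr Hom_Op)
qed

lemma extended_boolean_algebra_Hal:
  assumes "wf_variety \<Theta>" and "in_variety \<Theta> H"
  shows "extended_boolean_algebra \<Theta> X (srt (Hal \<Theta> H) X)"
proof -
  have "closed_extba X (Carr (W \<Theta> X)) (srt (Hal \<Theta> H) X)"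
    by (auto simp: closed_extba_def Hal_def)
  moreover have "boolean_axioms (srt (Hal \<Theta> H) X)"
    by (auto simp: boolean_axioms_def Hal_def)
  moreover have "quantifier_axioms X (srt (Hal \<Theta> H) X)"
    unfolding quantifier_axioms_def
  proof (intro conjI ballI)
    fix x y A assume "x \<in> X" "y \<in> X" "A \<in> carr (srt (Hal \<Theta> H) X)"
    then show "ex (srt (Hal \<Theta> H) X) x (ex (srt (Hal \<Theta> H) X) y A) =
        ex (srt (Hal \<Theta> H) X) y (ex (srt (Hal \<Theta> H) X) x A)"
      using ex_Hal_commute[OF assms] by (intro equalityI) (auto simp: Hal_def)
  next
    fix x A B
    assume A: "A \<in> carr (srt (Hal \<Theta> H) X)"
    let ?ex = "ex (srt (Hal \<Theta> H) X) x"
    have "?ex (A \<inter> ?ex B) = ?ex A \<inter> ?ex B"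
    proof (intro equalityI subsetI)
      fix \<mu> assume "\<mu> \<in> ?ex A \<inter> ?ex B"
      \<comment> \<open>Both witnesses agree with \<open>\<mu>\<close> off \<open>x\<close>, hence
        with each other, so the witness for \<open>A\<close> already lies in
        \<open>?ex B\<close>.\<close>
      then obtain \<nu> \<rho> where "\<mu> \<in> Points \<Theta> X H" "\<nu> \<in> A" "\<rho> \<in> B"
        and eq: "\<And>z. z \<in> X - {x} \<Longrightarrow> \<nu> (gen \<Theta> X z) = \<mu> (gen \<Theta> X z)"
          "\<And>z. z \<in> X - {x} \<Longrightarrow> \<rho> (gen \<Theta> X z) = \<mu> (gen \<Theta> X z)"
        by (auto simp: ex_Hal)
      moreover have "\<nu> \<in> Points \<Theta> X H" using A \<open>\<nu> \<in> A\<close> by (auto simp: Hal_def)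
      ultimately have "\<nu> \<in> ?ex B" unfolding ex_Hal by (intro conjI bexI[of _ \<rho>]) simp_all
      with \<open>\<mu> \<in> Points \<Theta> X H\<close> \<open>\<nu> \<in> A\<close> eq show "\<mu> \<in> ?ex (A \<inter> ?ex B)"
        unfolding ex_Hal[of _ _ _ _ _ "A \<inter> _"] by (intro conjI bexI[of _ \<nu>]) simp_all
    qed (auto simp: ex_Hal)
    then show "?ex (meet (srt (Hal \<Theta> H) X) A (?ex B)) = meet (srt (Hal \<Theta> H) X) (?ex A) (?ex B)"
      by (simp add: Hal_def)
  qed (auto simp: Hal_def le_def)
  ultimately show ?thesis
    by (simp add: extended_boolean_algebra_def equality_axioms_Hal)
qed

text \<open>Left to right, \<open>\<mu>\<close> is changed at \<open>y\<close> to the value of the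
  witness at \<open>x\<close>: since \<open>s\<close> sends \<open>x\<close> to \<open>y\<close> and
  no other \<open>s x'\<close> depends on \<open>y\<close>, the changed point composed with
  \<open>s\<close> is the witness. Right to left, points that agree off \<open>y\<close> have
  composites with \<open>s\<close> that agree off \<open>x\<close>, again by the support
  condition.\<close>

lemma sub_Hal_ex:
  fixes \<Theta> :: "('f, 'x) variety" and H :: "('f, 'h) algebra"
  assumes "wf_variety \<Theta>" and "in_variety \<Theta> H" and s: "s \<in> HomW \<Theta> X Y"
    and x: "x \<in> X" and y: "y \<in> Y" and sx: "s (gen \<Theta> X x) = gen \<Theta> Y y"
    and off: "\<forall>x' \<in> X - {x}. off_support \<Theta> Y y (s (gen \<Theta> X x'))"
    and A: "A \<subseteq> Points \<Theta> X H"
  shows "sub (Hal \<Theta> H) X Y s (ex (srt (Hal \<Theta> H) X) x A) =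
    ex (srt (Hal \<Theta> H) Y) y (sub (Hal \<Theta> H) X Y s A)"
proof (intro equalityI subsetI)
  have comp: "compose (Carr (W \<Theta> X)) \<mu> s \<in> Points \<Theta> X H" if "\<mu> \<in> Points \<Theta> Y H" for \<mu>
    using Hom_compose[OF is_algebra_W[OF assms(1)] s that] .
  have comp_gen: "compose (Carr (W \<Theta> X)) \<mu> s (gen \<Theta> X z) = \<mu> (s (gen \<Theta> X z))"
    if "z \<in> X" for z and \<mu> :: "_ \<Rightarrow> 'h"
    using that by (simp add: compose_eq gen_in_W)
  {
    fix \<mu>
    assume "\<mu> \<in> sub (Hal \<Theta> H) X Y s (ex (srt (Hal \<Theta> H) X) x A)"
    then obtain \<nu> where \<mu>: "\<mu> \<in> Points \<Theta> Y H" and \<nu>: "\<nu> \<in> A"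
      and \<nu>\<mu>: "\<forall>z \<in> X - {x}. \<nu> (gen \<Theta> X z) = compose (Carr (W \<Theta> X)) \<mu> s (gen \<Theta> X z)"
      by (auto simp: sub_Hal ex_Hal)
    have \<nu>P: "\<nu> \<in> Points \<Theta> X H" using \<nu> A by auto
    then have "(if z = y then \<nu> (gen \<Theta> X x) else \<mu> (gen \<Theta> Y z)) \<in> Carr H" if "z \<in> Y" for z
      using that \<mu> x by (auto intro: Hom_closed gen_in_W)
    then obtain \<nu>' where \<nu>': "\<nu>' \<in> Points \<Theta> Y H"
      and \<nu>'_gen: "\<And>z. z \<in> Y \<Longrightarrow>
        \<nu>' (gen \<Theta> Y z) = (if z = y then \<nu> (gen \<Theta> X x) else \<mu> (gen \<Theta> Y z))"
      by (rule Hom_W_extend[OF assms(1,2), of Y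
            "\<lambda>z. if z = y then \<nu> (gen \<Theta> X x) else \<mu> (gen \<Theta> Y z)"])
          (assumption, rule that)
    have "compose (Carr (W \<Theta> X)) \<nu>' s = \<nu>"
    proof (rule Hom_W_eqI[OF assms(1) comp[OF \<nu>'] \<nu>P])
      fix z assume z: "z \<in> X"
      show "compose (Carr (W \<Theta> X)) \<nu>' s (gen \<Theta> X z) = \<nu> (gen \<Theta> X z)"
      proof (cases "z = x")
        case True
        then show ?thesis using z y sx \<nu>'_gen by (simp add: comp_gen)
      next
        case False
        have "\<nu>' (s (gen \<Theta> X z)) = \<mu> (s (gen \<Theta> X z))"
          by (rule Hom_W_eq_off_support[OF assms(1) \<nu>' \<mu>, of y]) (use False z off \<nu>'_gen in auto)
        then show ?thesis using False z \<nu>\<mu> by (simp add: comp_gen)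
      qed
    qed
    then have "\<nu>' \<in> sub (Hal \<Theta> H) X Y s A" using \<nu> \<nu>' by (simp add: sub_Hal)
    with \<mu> \<nu>'_gen show "\<mu> \<in> ex (srt (Hal \<Theta> H) Y) y (sub (Hal \<Theta> H) X Y s A)"
      unfolding ex_Hal by (intro conjI bexI[of _ \<nu>']) simp_all
  next
    fix \<mu>
    assume "\<mu> \<in> ex (srt (Hal \<Theta> H) Y) y (sub (Hal \<Theta> H) X Y s A)"
    then obtain \<nu> where \<mu>: "\<mu> \<in> Points \<Theta> Y H" and \<nu>: "\<nu> \<in> Points \<Theta> Y H"
      "compose (Carr (W \<Theta> X)) \<nu> s \<in> A"
      and \<nu>\<mu>: "\<And>z. z \<in> Y - {y} \<Longrightarrow> \<nu> (gen \<Theta> Y z) = \<mu> (gen \<Theta> Y z)"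
      by (auto simp: sub_Hal ex_Hal)
    have "\<nu> (s (gen \<Theta> X z)) = \<mu> (s (gen \<Theta> X z))" if "z \<in> X - {x}" for z
      by (rule Hom_W_eq_off_support[OF assms(1) \<nu>(1) \<mu>, of y]) (use \<nu>\<mu> off that in auto)
    then have "compose (Carr (W \<Theta> X)) \<nu> s (gen \<Theta> X z) = compose (Carr (W \<Theta> X)) \<mu> s (gen \<Theta> X z)"
      if "z \<in> X - {x}" for z
      using that by (simp add: comp_gen)
    with \<mu> \<nu>(2) comp[OF \<mu>] show "\<mu> \<in> sub (Hal \<Theta> H) X Y s (ex (srt (Hal \<Theta> H) X) x A)"
      unfolding sub_Hal ex_Hal by (intro conjI bexI[of _ "compose (Carr (W \<Theta> X)) \<nu> s"]) auto
  }
qed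

lemma halmos_algebra_Hal:
  fixes \<Theta> :: "('f, 'x) variety" and H :: "('f, 'h) algebra"
  assumes wf: "wf_variety \<Theta>" and H: "in_variety \<Theta> H"
  shows "halmos_algebra \<Theta> (Hal \<Theta> H)"
  unfolding halmos_algebra_def
proof (intro conjI allI impI ballI; (elim conjE)?)
  note comp = Hom_compose[OF is_algebra_W[OF wf]]
  fix X Y :: "'x set" and s
  assume s: "s \<in> HomW \<Theta> X Y"
  {
    show "boolean_hom (srt (Hal \<Theta> H) X) (srt (Hal \<Theta> H) Y) (sub (Hal \<Theta> H) X Y s)"
      using comp[OF s] by (auto simp: boolean_hom_def Hal_def)
  next
    fix w w' assume "w \<in> Carr (W \<Theta> X)" "w' \<in> Carr (W \<Theta> X)"
    then show "sub (Hal \<Theta> H) X Y s (equ (srt (Hal \<Theta> H) X) w w') = equ (srt (Hal \<Theta> H) Y) (s w) (s w')"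
      using comp[OF s] by (auto simp: Hal_def compose_eq)
  next
    fix x y A
    assume "A \<in> carr (srt (Hal \<Theta> H) X)" "x \<in> X" "y \<in> Y" "s (gen \<Theta> X x) = gen \<Theta> Y y"
      "\<forall>x' \<in> X - {x}. off_support \<Theta> Y y (s (gen \<Theta> X x'))"
    then show "sub (Hal \<Theta> H) X Y s (ex (srt (Hal \<Theta> H) X) x A) =
        ex (srt (Hal \<Theta> H) Y) y (sub (Hal \<Theta> H) X Y s A)"
      by (intro sub_Hal_ex[OF wf H s]) (auto simp: Hal_def)
  next
    fix s' x A
    assume s': "s' \<in> HomW \<Theta> X Y" and eq: "\<forall>x' \<in> X - {x}. s (gen \<Theta> X x') = s' (gen \<Theta> X x')"
    \<comment> \<open>Membership of a point in a set quantified over \<open>x\<close> depends only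
      on its values off \<open>x\<close>, and there the two composites agree.\<close>
    have "compose (Carr (W \<Theta> X)) \<mu> s (gen \<Theta> X z) = compose (Carr (W \<Theta> X)) \<mu> s' (gen \<Theta> X z)"
      if "z \<in> X - {x}" for z and \<mu> :: "_ \<Rightarrow> 'h"
      using that eq by (simp add: compose_eq gen_in_W)
    with comp[OF s] comp[OF s'] show "sub (Hal \<Theta> H) X Y s (ex (srt (Hal \<Theta> H) X) x A) =
        sub (Hal \<Theta> H) X Y s' (ex (srt (Hal \<Theta> H) X) x A)"
      unfolding set_eq_iff sub_Hal ex_Hal by auto
  next
    fix Z t A
    assume t: "t \<in> HomW \<Theta> Y Z" and A: "A \<in> carr (srt (Hal \<Theta> H) X)"
    \<comment> \<open>\<open>compose\<close> is undefined off its carrier, so associativity uses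
      that \<open>s\<close> maps into the carrier of \<open>W(Y)\<close>.\<close>
    have "compose (Carr (W \<Theta> X)) \<mu> (compose (Carr (W \<Theta> X)) t s) =
      compose (Carr (W \<Theta> X)) (compose (Carr (W \<Theta> Y)) \<mu> t) s" for \<mu> :: "_ \<Rightarrow> 'h"
      using Hom_closed[OF s] by (auto simp: compose_def fun_eq_iff)
    then show "sub (Hal \<Theta> H) X Z (compose (Carr (W \<Theta> X)) t s) A =
        sub (Hal \<Theta> H) Y Z t (sub (Hal \<Theta> H) X Y s A)"
      using comp[OF t] by (auto simp: Hal_def)
  }
next
  fix X :: "'x set" and A
  assume "A \<in> carr (srt (Hal \<Theta> H) X)"
  moreover have "compose (Carr (W \<Theta> X)) \<mu> (restrict id (Carr (W \<Theta> X))) = \<mu>"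
    if "\<mu> \<in> Points \<Theta> X H" for \<mu>
    using Hom_extensional[OF that] by (auto simp: compose_def extensional_def)
  ultimately show "sub (Hal \<Theta> H) X X (restrict id (Carr (W \<Theta> X))) A = A"
    by (auto simp: Hal_def)
next
  note comp = Hom_compose[OF is_algebra_W[OF wf]]
  fix X :: "'x set" and x s s' w w' A
  assume x: "x \<in> X" and w: "w \<in> Carr (W \<Theta> X)" "w' \<in> Carr (W \<Theta> X)"
    and "replaces \<Theta> X x w s" "replaces \<Theta> X x w' s'"
  then have s: "s \<in> HomW \<Theta> X X" "s' \<in> HomW \<Theta> X X" "s (gen \<Theta> X x) = w" "s' (gen \<Theta> X x) = w'"
    "\<And>z. z \<in> X - {x} \<Longrightarrow> s (gen \<Theta> X z) = s' (gen \<Theta> X z)"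
    by (auto simp: replaces_def)
  \<comment> \<open>The replacements agree on the generators other than \<open>x\<close>, so a point
    that identifies \<open>w\<close> and \<open>w'\<close> has the same composite with both.\<close>
  have "compose (Carr (W \<Theta> X)) \<mu> s = compose (Carr (W \<Theta> X)) \<mu> s'"
    if \<mu>: "\<mu> \<in> Points \<Theta> X H" and eq: "\<mu> w = \<mu> w'" for \<mu>
  proof (rule Hom_W_eqI[OF wf comp[OF s(1) \<mu>] comp[OF s(2) \<mu>]])
    fix z assume "z \<in> X"
    then show "compose (Carr (W \<Theta> X)) \<mu> s (gen \<Theta> X z) = compose (Carr (W \<Theta> X)) \<mu> s' (gen \<Theta> X z)"
      using s eq by (cases "z = x") (simp_all add: compose_eq gen_in_W)
  qed
  then show "le (srt (Hal \<Theta> H) X)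
      (meet (srt (Hal \<Theta> H) X) (sub (Hal \<Theta> H) X X s A) (equ (srt (Hal \<Theta> H) X) w w'))
      (sub (Hal \<Theta> H) X X s' A)"
    by (auto simp: le_def Hal_def)
qed (rule extended_boolean_algebra_Hal[OF wf H])

section \<open>Homomorphisms and quotients\<close>

text \<open>The condition that operations stay in their carriers, separated from the axioms:
  \<open>abs_free\<close> meets it although its formal operations violate the Boolean laws, and its
  quotients inherit it.\<close>

definition closed_halmos :: "('f, 'x) variety \<Rightarrow> ('x, ('f, 'x) tm set, 'b) halmos \<Rightarrow> bool" where
  "closed_halmos \<Theta> K \<longleftrightarrow>
     (\<forall>X. finite X \<longrightarrow> closed_extba X (Carr (W \<Theta> X)) (srt K X)) \<and>
     (\<forall>X Y s. \<forall>a \<in> carr (srt K X). finite X \<and> finite Y \<and> s \<in> HomW \<Theta> X Y \<longrightarrow>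
        sub K X Y s a \<in> carr (srt K Y))"

lemma closed_halmosD:
  assumes "closed_halmos \<Theta> K" and "finite X"
  shows "zero (srt K X) \<in> carr (srt K X)"
    and "one (srt K X) \<in> carr (srt K X)"
    and "a \<in> carr (srt K X) \<Longrightarrow> neg (srt K X) a \<in> carr (srt K X)"
    and "a \<in> carr (srt K X) \<Longrightarrow> b \<in> carr (srt K X) \<Longrightarrow> meet (srt K X) a b \<in> carr (srt K X)"
    and "a \<in> carr (srt K X) \<Longrightarrow> b \<in> carr (srt K X) \<Longrightarrow> join (srt K X) a b \<in> carr (srt K X)"
    and "x \<in> X \<Longrightarrow> a \<in> carr (srt K X) \<Longrightarrow> ex (srt K X) x a \<in> carr (srt K X)"
    and "w \<in> Carr (W \<Theta> X) \<Longrightarrow> w' \<in> Carr (W \<Theta> X) \<Longrightarrow> equ (srt K X) w w' \<in> carr (srt K X)"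
    and "finite Y \<Longrightarrow> s \<in> HomW \<Theta> X Y \<Longrightarrow> a \<in> carr (srt K X) \<Longrightarrow> sub K X Y s a \<in> carr (srt K Y)"
proof -
  have "closed_extba X (Carr (W \<Theta> X)) (srt K X)"
    using assms unfolding closed_halmos_def by blast
  then show "zero (srt K X) \<in> carr (srt K X)"
    and "one (srt K X) \<in> carr (srt K X)"
    and "a \<in> carr (srt K X) \<Longrightarrow> neg (srt K X) a \<in> carr (srt K X)"
    and "a \<in> carr (srt K X) \<Longrightarrow> b \<in> carr (srt K X) \<Longrightarrow> meet (srt K X) a b \<in> carr (srt K X)"
    and "a \<in> carr (srt K X) \<Longrightarrow> b \<in> carr (srt K X) \<Longrightarrow> join (srt K X) a b \<in> carr (srt K X)"
    and "x \<in> X \<Longrightarrow> a \<in> carr (srt K X) \<Longrightarrow> ex (srt K X) x a \<in> carr (srt K X)"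
    and "w \<in> Carr (W \<Theta> X) \<Longrightarrow> w' \<in> Carr (W \<Theta> X) \<Longrightarrow> equ (srt K X) w w' \<in> carr (srt K X)"
    unfolding closed_extba_def by simp_all
  show "finite Y \<Longrightarrow> s \<in> HomW \<Theta> X Y \<Longrightarrow> a \<in> carr (srt K X) \<Longrightarrow> sub K X Y s a \<in> carr (srt K Y)"
    using assms unfolding closed_halmos_def by blast
qed

lemma closed_halmos_algebra:
  assumes "halmos_algebra \<Theta> K"
  shows "closed_halmos \<Theta> K"
proof -
  note K = assms[unfolded halmos_algebra_def]
  have sub: "sub K X Y s \<in> carr (srt K X) \<rightarrow> carr (srt K Y)"
    if "finite X \<and> finite Y \<and> s \<in> HomW \<Theta> X Y" for X Y s
    using K[THEN conjunct2, THEN conjunct1, rule_format, OF that]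
    unfolding boolean_hom_def by (rule conjunct1)
  have ext: "closed_extba X (Carr (W \<Theta> X)) (srt K X)" if "finite X" for X
    using K[THEN conjunct1, rule_format, OF that]
    unfolding extended_boolean_algebra_def by (rule conjunct1)
  show ?thesis
    unfolding closed_halmos_def
    by (intro conjI allI impI ballI) (erule ext, rule funcset_mem[OF sub])
qed

section \<open>Homomorphisms of multi-sorted algebras\<close>

lemma halmos_homD:
  assumes "halmos_hom \<Theta> K L h" and "finite X"
  shows "a \<in> carr (srt K X) \<Longrightarrow> h X a \<in> carr (srt L X)"
    and "h X (zero (srt K X)) = zero (srt L X)"
    and "h X (one (srt K X)) = one (srt L X)"
    and "a \<in> carr (srt K X) \<Longrightarrow> h X (neg (srt K X) a) = neg (srt L X) (h X a)"
    and "a \<in> carr (srt K X) \<Longrightarrow> b \<in> carr (srt K X) \<Longrightarrow>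
      h X (meet (srt K X) a b) = meet (srt L X) (h X a) (h X b)"
    and "a \<in> carr (srt K X) \<Longrightarrow> b \<in> carr (srt K X) \<Longrightarrow>
      h X (join (srt K X) a b) = join (srt L X) (h X a) (h X b)"
    and "x \<in> X \<Longrightarrow> a \<in> carr (srt K X) \<Longrightarrow> h X (ex (srt K X) x a) = ex (srt L X) x (h X a)"
    and "w \<in> Carr (W \<Theta> X) \<Longrightarrow> w' \<in> Carr (W \<Theta> X) \<Longrightarrow> h X (equ (srt K X) w w') = equ (srt L X) w w'"
    and "finite Y \<Longrightarrow> s \<in> HomW \<Theta> X Y \<Longrightarrow> a \<in> carr (srt K X) \<Longrightarrow>
      h Y (sub K X Y s a) = sub L X Y s (h X a)"
  using assms by (auto simp: halmos_hom_def extba_hom_def boolean_hom_def)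

lemma halmos_homI:
  assumes "\<And>X a. finite X \<Longrightarrow> a \<in> carr (srt K X) \<Longrightarrow> h X a \<in> carr (srt L X)"
    and "\<And>X. finite X \<Longrightarrow> h X (zero (srt K X)) = zero (srt L X)"
    and "\<And>X. finite X \<Longrightarrow> h X (one (srt K X)) = one (srt L X)"
    and "\<And>X a. finite X \<Longrightarrow> a \<in> carr (srt K X) \<Longrightarrow> h X (neg (srt K X) a) = neg (srt L X) (h X a)"
    and "\<And>X a b. finite X \<Longrightarrow> a \<in> carr (srt K X) \<Longrightarrow> b \<in> carr (srt K X) \<Longrightarrow>
      h X (meet (srt K X) a b) = meet (srt L X) (h X a) (h X b)"
    and "\<And>X a b. finite X \<Longrightarrow> a \<in> carr (srt K X) \<Longrightarrow> b \<in> carr (srt K X) \<Longrightarrow>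
      h X (join (srt K X) a b) = join (srt L X) (h X a) (h X b)"
    and "\<And>X x a. finite X \<Longrightarrow> x \<in> X \<Longrightarrow> a \<in> carr (srt K X) \<Longrightarrow>
      h X (ex (srt K X) x a) = ex (srt L X) x (h X a)"
    and "\<And>X w w'. finite X \<Longrightarrow> w \<in> Carr (W \<Theta> X) \<Longrightarrow> w' \<in> Carr (W \<Theta> X) \<Longrightarrow>
      h X (equ (srt K X) w w') = equ (srt L X) w w'"
    and "\<And>X Y s a. finite X \<Longrightarrow> finite Y \<Longrightarrow> s \<in> HomW \<Theta> X Y \<Longrightarrow> a \<in> carr (srt K X) \<Longrightarrow>
      h Y (sub K X Y s a) = sub L X Y s (h X a)"
  shows "halmos_hom \<Theta> K L h"
  using assms by (simp add: halmos_hom_def extba_hom_def boolean_hom_def Pi_def)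

lemma boolean_axiomsD:
  assumes "boolean_axioms B" and "a \<in> carr B"
  shows "b \<in> carr B \<Longrightarrow> meet B a b = meet B b a"
    and "b \<in> carr B \<Longrightarrow> join B a b = join B b a"
    and "b \<in> carr B \<Longrightarrow> c \<in> carr B \<Longrightarrow> meet B a (join B b c) = join B (meet B a b) (meet B a c)"
    and "b \<in> carr B \<Longrightarrow> c \<in> carr B \<Longrightarrow> join B a (meet B b c) = meet B (join B a b) (join B a c)"
    and "meet B a (one B) = a"
    and "join B a (zero B) = a"
    and "meet B a (neg B a) = zero B"
    and "join B a (neg B a) = one B"
proof -
  note B = assms(1)[unfolded boolean_axioms_def]
  note B1 = B[THEN conjunct1, rule_format, OF assms(2)]
    and B2 = B[THEN conjunct2, THEN conjunct1, rule_format, OF assms(2)]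
    and B3 = B[THEN conjunct2, THEN conjunct2, THEN conjunct1, rule_format, OF assms(2)]
    and B4 = B[THEN conjunct2, THEN conjunct2, THEN conjunct2, rule_format, OF assms(2)]
  show "b \<in> carr B \<Longrightarrow> meet B a b = meet B b a" and "b \<in> carr B \<Longrightarrow> join B a b = join B b a"
    using B1 by blast+
  show "b \<in> carr B \<Longrightarrow> c \<in> carr B \<Longrightarrow> meet B a (join B b c) = join B (meet B a b) (meet B a c)"
    and "b \<in> carr B \<Longrightarrow> c \<in> carr B \<Longrightarrow> join B a (meet B b c) = meet B (join B a b) (join B a c)"
    using B2 by blast+
  show "meet B a (one B) = a" and "join B a (zero B) = a" using B3 by blast+
  show "meet B a (neg B a) = zero B" and "join B a (neg B a) = one B" using B4 by blast+
qed

text \<open>The Halmos axioms are universally quantified (conditional) equations, so they pass to subalgebras.\<close>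

lemma halmos_algebra_inj_hom:
  fixes \<Theta> :: "('f, 'x) variety"
  assumes wf: "wf_variety \<Theta>"
    and K: "closed_halmos \<Theta> K" and L: "halmos_algebra \<Theta> L" and h: "halmos_hom \<Theta> K L h"
    and inj: "\<And>X. finite X \<Longrightarrow> inj_on (h X) (carr (srt K X))"
  shows "halmos_algebra \<Theta> K"
proof -
  note cl = closed_halmosD[OF K] and hm = halmos_homD[OF h]
  note L' = L[unfolded halmos_algebra_def]
  note Lext = L'[THEN conjunct1, rule_format]
  note L' = L'[THEN conjunct2]
  note Lbool = L'[THEN conjunct1, rule_format]
  note L' = L'[THEN conjunct2]
  note Lid = L'[THEN conjunct1, rule_format]
  note L' = L'[THEN conjunct2]
  note Lcomp = L'[THEN conjunct1, rule_format]
  note L' = L'[THEN conjunct2]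
  note Lex1 = L'[THEN conjunct1, rule_format]
  note L' = L'[THEN conjunct2]
  note Lex2 = L'[THEN conjunct1, rule_format]
  note L' = L'[THEN conjunct2]
  note Lequ = L'[THEN conjunct1, rule_format]
  note Lrep = L'[THEN conjunct2, rule_format]
  \<comment> \<open>Equations are checked in \<open>L\<close> after applying \<open>h\<close>, and
    injectivity carries them back. The next fact does the same for \<open>le\<close>, which is the
    equation \<open>meet a b = a\<close>.\<close>
  have eqI: "a = b"
    if "finite X" "a \<in> carr (srt K X)" "b \<in> carr (srt K X)" "h X a = h X b" for X a b
    using inj that by (meson inj_onD)
  have leI: "le (srt K X) a b"
    if "finite X" "a \<in> carr (srt K X)" "b \<in> carr (srt K X)" "le (srt L X) (h X a) (h X b)" for X a b
    using that eqI[of X "meet (srt K X) a b" a] by (simp add: le_def cl hm)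
  have bool: "boolean_axioms (srt K X)" if X: "finite X" for X
  proof -
    have "boolean_axioms (srt L X)" using Lext[OF X] by (simp add: extended_boolean_algebra_def)
    note LB = boolean_axiomsD[OF this]
    show ?thesis
      unfolding boolean_axioms_def
      by (intro conjI ballI; rule eqI[OF X]; simp add: cl hm X; (blast intro: LB hm(1)[OF X])?)
  qed
  have quan: "quantifier_axioms X (srt K X)" if X: "finite X" for X
  proof -
    have "quantifier_axioms X (srt L X)" using Lext[OF X] by (simp add: extended_boolean_algebra_def)
    note LQ = this[unfolded quantifier_axioms_def]
    show ?thesis
      unfolding quantifier_axioms_def
      by (intro conjI ballI; (rule eqI[OF X] | rule leI[OF X]); simp add: cl hm X;
        use LQ hm(1)[OF X] in blast)
  qed
  have equa: "equality_axioms (sig \<Theta>) (W \<Theta> X) (srt K X)" if X: "finite X" for X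
  proof -
    have "equality_axioms (sig \<Theta>) (W \<Theta> X) (srt L X)"
      using Lext[OF X] by (simp add: extended_boolean_algebra_def)
    note LE = this[unfolded equality_axioms_def]
    note LE1 = LE[THEN conjunct1, rule_format]
      and LE2 = LE[THEN conjunct2, THEN conjunct1, rule_format]
      and LE3 = LE[THEN conjunct2, THEN conjunct2, THEN conjunct1, rule_format]
      and LE4 = LE[THEN conjunct2, THEN conjunct2, THEN conjunct2, rule_format]
    \<comment> \<open>This conjunction has variable length, so its commuting with \<open>h\<close>
      needs an induction over the lists; membership in the carrier is carried along so that
      \<open>h\<close> can be moved through each meet.\<close>
    have foldr: "foldr (meet (srt K X)) (map2 (equ (srt K X)) ws ws') (one (srt K X)) \<in> carr (srt K X) \<and>
        h X (foldr (meet (srt K X)) (map2 (equ (srt K X)) ws ws') (one (srt K X))) =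
        foldr (meet (srt L X)) (map2 (equ (srt L X)) ws ws') (one (srt L X))"
      if "length ws' = length ws" "set ws \<subseteq> Carr (W \<Theta> X)" "set ws' \<subseteq> Carr (W \<Theta> X)" for ws ws'
      using that(1)[symmetric] that(2,3)
      by (induction ws ws' rule: list_induct2) (simp_all add: cl hm X)
    show ?thesis
      unfolding equality_axioms_def
    proof (intro conjI ballI allI impI)
      fix w assume "w \<in> Carr (W \<Theta> X)"
      then show "equ (srt K X) w w = one (srt K X)"
        by (intro eqI[OF X]) (simp_all add: cl hm X LE1)
    next
      fix w w' assume "w \<in> Carr (W \<Theta> X)" "w' \<in> Carr (W \<Theta> X)"
      then show "le (srt K X) (equ (srt K X) w w') (equ (srt K X) w' w)"
        by (intro leI[OF X]) (simp_all add: cl hm X LE2)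
    next
      fix w w' w'' assume "w \<in> Carr (W \<Theta> X)" "w' \<in> Carr (W \<Theta> X)" "w'' \<in> Carr (W \<Theta> X)"
      then show "le (srt K X) (meet (srt K X) (equ (srt K X) w w') (equ (srt K X) w' w''))
          (equ (srt K X) w w'')"
        by (intro leI[OF X]) (simp_all add: cl hm X LE3)
    next
      fix f ws ws'
      assume *: "(f, length ws) \<in> sig \<Theta> \<and> length ws' = length ws \<and>
        set ws \<subseteq> Carr (W \<Theta> X) \<and> set ws' \<subseteq> Carr (W \<Theta> X)"
      have "Op (W \<Theta> X) f ws \<in> Carr (W \<Theta> X)" "Op (W \<Theta> X) f ws' \<in> Carr (W \<Theta> X)"
        using * is_algebra_W[OF wf] by (auto simp: is_algebra_def)
      with * show "le (srt K X) (foldr (meet (srt K X)) (map2 (equ (srt K X)) ws ws') (one (srt K X)))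
          (equ (srt K X) (Op (W \<Theta> X) f ws) (Op (W \<Theta> X) f ws'))"
        by (intro leI[OF X]) (simp_all add: cl hm X LE4 foldr)
    qed
  qed
  show ?thesis
    unfolding halmos_algebra_def
  proof (intro conjI allI ballI impI; (elim conjE)?)
    fix X :: "'x set" assume "finite X"
    then show "extended_boolean_algebra \<Theta> X (srt K X)"
      using K bool quan equa by (simp add: extended_boolean_algebra_def closed_halmos_def)
  next
    fix X Y :: "'x set" and s assume XY: "finite X" "finite Y" "s \<in> HomW \<Theta> X Y"
    have "boolean_hom (srt L X) (srt L Y) (sub L X Y s)" using Lbool XY by blast
    note LH = this[unfolded boolean_hom_def]
    show "boolean_hom (srt K X) (srt K Y) (sub K X Y s)"
      unfolding boolean_hom_def
      by (intro conjI ballI funcsetI; (rule eqI[OF XY(2)])?; simp add: cl hm XY LH)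
  next
    fix X :: "'x set" and a assume "a \<in> carr (srt K X)" "finite X"
    then show "sub K X X (restrict id (Carr (W \<Theta> X))) a = a"
      using Hom_restrict_id[OF is_algebra_W[OF wf]] by (intro eqI[of X]) (simp_all add: cl hm Lid)
  next
    fix X Y Z :: "'x set" and s t a
    assume "a \<in> carr (srt K X)" "finite X" "finite Y" "finite Z" "s \<in> HomW \<Theta> X Y" "t \<in> HomW \<Theta> Y Z"
    moreover from this have "compose (Carr (W \<Theta> X)) t s \<in> HomW \<Theta> X Z"
      using Hom_compose[OF is_algebra_W[OF wf]] by blast
    \<comment> \<open>The intermediate sort \<open>Y\<close> does not occur on the left of
      \<open>Lcomp\<close> and has to be named.\<close>
    ultimately show "sub K X Z (compose (Carr (W \<Theta> X)) t s) a = sub K Y Z t (sub K X Y s a)"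
      by (intro eqI[of Z]) (simp_all add: cl hm Lcomp[where Y = Y])
  next
    fix X Y :: "'x set" and s s' x a
    assume "a \<in> carr (srt K X)" "finite X" "finite Y" "s \<in> HomW \<Theta> X Y" "s' \<in> HomW \<Theta> X Y" "x \<in> X"
      "\<forall>x' \<in> X - {x}. s (gen \<Theta> X x') = s' (gen \<Theta> X x')"
    then show "sub K X Y s (ex (srt K X) x a) = sub K X Y s' (ex (srt K X) x a)"
      by (intro eqI[of Y]) (simp_all add: cl hm Lex1[where s = s and s' = s'])
  next
    fix X Y :: "'x set" and s x y a
    assume "a \<in> carr (srt K X)" "finite X" "finite Y" "s \<in> HomW \<Theta> X Y" "x \<in> X" "y \<in> Y"
      "s (gen \<Theta> X x) = gen \<Theta> Y y" "\<forall>x' \<in> X - {x}. off_support \<Theta> Y y (s (gen \<Theta> X x'))"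
    then show "sub K X Y s (ex (srt K X) x a) = ex (srt K Y) y (sub K X Y s a)"
      by (intro eqI[of Y]) (simp_all add: cl hm Lex2[where y = y])
  next
    fix X Y :: "'x set" and s w w'
    assume "w \<in> Carr (W \<Theta> X)" "w' \<in> Carr (W \<Theta> X)" "finite X" "finite Y" "s \<in> HomW \<Theta> X Y"
    then show "sub K X Y s (equ (srt K X) w w') = equ (srt K Y) (s w) (s w')"
      by (intro eqI[of Y]) (simp_all add: cl hm Hom_closed Lequ)
  next
    fix X :: "'x set" and x s s' w w' a
    assume "w \<in> Carr (W \<Theta> X)" "w' \<in> Carr (W \<Theta> X)" "a \<in> carr (srt K X)" "finite X" "x \<in> X"
      and "replaces \<Theta> X x w s" "replaces \<Theta> X x w' s'"
    moreover from this have "s \<in> HomW \<Theta> X X" "s' \<in> HomW \<Theta> X X" by (auto simp: replaces_def)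
    ultimately show "le (srt K X) (meet (srt K X) (sub K X X s a) (equ (srt K X) w w'))
        (sub K X X s' a)"
      by (intro leI[of X]) (simp_all add: cl hm Lrep)
  qed
qed

section \<open>Congruences and quotients\<close>

lemma congruenceD:
  assumes "congruence \<Theta> K \<theta>" and "finite X"
  shows "equiv (carr (srt K X)) (\<theta> X)"
    and "(a, a') \<in> \<theta> X \<Longrightarrow> (neg (srt K X) a, neg (srt K X) a') \<in> \<theta> X"
    and "(a, a') \<in> \<theta> X \<Longrightarrow> (b, b') \<in> \<theta> X \<Longrightarrow> (meet (srt K X) a b, meet (srt K X) a' b') \<in> \<theta> X"
    and "(a, a') \<in> \<theta> X \<Longrightarrow> (b, b') \<in> \<theta> X \<Longrightarrow> (join (srt K X) a b, join (srt K X) a' b') \<in> \<theta> X"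
    and "x \<in> X \<Longrightarrow> (a, a') \<in> \<theta> X \<Longrightarrow> (ex (srt K X) x a, ex (srt K X) x a') \<in> \<theta> X"
    and "finite Y \<Longrightarrow> s \<in> HomW \<Theta> X Y \<Longrightarrow> (a, a') \<in> \<theta> X \<Longrightarrow>
      (sub K X Y s a, sub K X Y s a') \<in> \<theta> Y"
proof -
  note C = assms(1)[unfolded congruence_def]
  note D = C[THEN conjunct1, rule_format, OF assms(2)]
  note D' = D[THEN conjunct2]
  show "equiv (carr (srt K X)) (\<theta> X)" using D by (rule conjunct1)
  show "(a, a') \<in> \<theta> X \<Longrightarrow> (neg (srt K X) a, neg (srt K X) a') \<in> \<theta> X"
    using D'[THEN conjunct1, THEN bspec, of "(a, a')"] by simp
  show "(a, a') \<in> \<theta> X \<Longrightarrow> (b, b') \<in> \<theta> X \<Longrightarrow> (meet (srt K X) a b, meet (srt K X) a' b') \<in> \<theta> X"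
    and "(a, a') \<in> \<theta> X \<Longrightarrow> (b, b') \<in> \<theta> X \<Longrightarrow> (join (srt K X) a b, join (srt K X) a' b') \<in> \<theta> X"
    using D'[THEN conjunct2, THEN conjunct1, THEN bspec, of "(a, a')"] by (auto dest: bspec[of _ _ "(b, b')"])
  show "x \<in> X \<Longrightarrow> (a, a') \<in> \<theta> X \<Longrightarrow> (ex (srt K X) x a, ex (srt K X) x a') \<in> \<theta> X"
    using D'[THEN conjunct2, THEN conjunct2, rule_format, of x "(a, a')"] by simp
  show "finite Y \<Longrightarrow> s \<in> HomW \<Theta> X Y \<Longrightarrow> (a, a') \<in> \<theta> X \<Longrightarrow>
      (sub K X Y s a, sub K X Y s a') \<in> \<theta> Y"
    using C[THEN conjunct2, rule_format, of "(a, a')" X Y s] assms(2) by simp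
qed

text \<open>The closure conditions are inherited from the members. Nonemptiness keeps the
  intersection inside the square of the carrier, since an empty intersection is the universal
  relation.\<close>

lemma congruence_Inter:
  assumes "F \<noteq> {}" and F: "\<And>\<theta>. \<theta> \<in> F \<Longrightarrow> congruence \<Theta> K \<theta>"
  shows "congruence \<Theta> K (\<lambda>X. \<Inter>\<theta>\<in>F. \<theta> X)"
proof -
  have "equiv (carr (srt K X)) (\<Inter>\<theta>\<in>F. \<theta> X)" if "finite X" for X
  proof (rule equivI)
    have eq: "equiv (carr (srt K X)) (\<theta> X)" if "\<theta> \<in> F" for \<theta>
      using F[OF that] \<open>finite X\<close> by (rule congruenceD(1))
    show "(\<Inter>\<theta>\<in>F. \<theta> X) \<subseteq> carr (srt K X) \<times> carr (srt K X)"
    proof -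
      obtain \<theta> where "\<theta> \<in> F" using assms(1) by blast
      with equiv_type[OF eq[OF this]] show ?thesis by blast
    qed
    show "refl_on (carr (srt K X)) (\<Inter>\<theta>\<in>F. \<theta> X)"
      using eq by (auto simp: equiv_def refl_on_def)
    show "sym (\<Inter>\<theta>\<in>F. \<theta> X)" using eq by (auto simp: equiv_def sym_def)
    show "trans (\<Inter>\<theta>\<in>F. \<theta> X)"
      using eq by (intro trans_INTER ballI) (auto simp: equiv_def)
  qed
  then show ?thesis
    unfolding congruence_def by (auto dest: congruenceD(2-)[OF F])
qed

lemma congruence_kernel:
  assumes "closed_halmos \<Theta> K" and "halmos_hom \<Theta> K L h"
  shows "congruence \<Theta> K (\<lambda>X. {(a, b). a \<in> carr (srt K X) \<and> b \<in> carr (srt K X) \<and> h X a = h X b})"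
  unfolding congruence_def
  by (auto simp: closed_halmosD[OF assms(1)] halmos_homD[OF assms(2)]
      intro!: equivI refl_onI symI transI)

text \<open>The unions in \<open>quot\<close> range over all representatives; compatibility of
  \<open>\<theta>\<close> with the operations makes all sets in such a union equal, so it collapses
  to a single class.\<close>

lemma quot_srt:
  assumes cong: "congruence \<Theta> K \<theta>" and X: "finite X"
  shows "carr (srt (quot K \<theta>) X) = carr (srt K X) // \<theta> X"
    and "zero (srt (quot K \<theta>) X) = \<theta> X `` {zero (srt K X)}"
    and "one (srt (quot K \<theta>) X) = \<theta> X `` {one (srt K X)}"
    and "equ (srt (quot K \<theta>) X) w w' = \<theta> X `` {equ (srt K X) w w'}"
    and "a \<in> carr (srt K X) \<Longrightarrow> neg (srt (quot K \<theta>) X) (\<theta> X `` {a}) = \<theta> X `` {neg (srt K X) a}"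
    and "a \<in> carr (srt K X) \<Longrightarrow> b \<in> carr (srt K X) \<Longrightarrow>
      meet (srt (quot K \<theta>) X) (\<theta> X `` {a}) (\<theta> X `` {b}) = \<theta> X `` {meet (srt K X) a b}"
    and "a \<in> carr (srt K X) \<Longrightarrow> b \<in> carr (srt K X) \<Longrightarrow>
      join (srt (quot K \<theta>) X) (\<theta> X `` {a}) (\<theta> X `` {b}) = \<theta> X `` {join (srt K X) a b}"
    and "x \<in> X \<Longrightarrow> a \<in> carr (srt K X) \<Longrightarrow>
      ex (srt (quot K \<theta>) X) x (\<theta> X `` {a}) = \<theta> X `` {ex (srt K X) x a}"
    and "finite Y \<Longrightarrow> s \<in> HomW \<Theta> X Y \<Longrightarrow> a \<in> carr (srt K X) \<Longrightarrow>
      sub (quot K \<theta>) X Y s (\<theta> X `` {a}) = \<theta> Y `` {sub K X Y s a}"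
proof -
  note eq = congruenceD(1)[OF cong] and D = congruenceD(2-)[OF cong X]
  note un = UN_equiv_class[OF eq[OF X]] and un2 = UN_equiv_class2[OF eq[OF X] eq[OF X]]
  show "a \<in> carr (srt K X) \<Longrightarrow> neg (srt (quot K \<theta>) X) (\<theta> X `` {a}) = \<theta> X `` {neg (srt K X) a}"
    unfolding quot_def by simp (rule un, auto intro!: congruentI equiv_class_eq[OF eq[OF X]] D)
  show "a \<in> carr (srt K X) \<Longrightarrow> b \<in> carr (srt K X) \<Longrightarrow>
      meet (srt (quot K \<theta>) X) (\<theta> X `` {a}) (\<theta> X `` {b}) = \<theta> X `` {meet (srt K X) a b}"
    unfolding quot_def by simp (rule un2, auto intro!: congruent2I' equiv_class_eq[OF eq[OF X]] D)
  show "a \<in> carr (srt K X) \<Longrightarrow> b \<in> carr (srt K X) \<Longrightarrow>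
      join (srt (quot K \<theta>) X) (\<theta> X `` {a}) (\<theta> X `` {b}) = \<theta> X `` {join (srt K X) a b}"
    unfolding quot_def by simp (rule un2, auto intro!: congruent2I' equiv_class_eq[OF eq[OF X]] D)
  show "x \<in> X \<Longrightarrow> a \<in> carr (srt K X) \<Longrightarrow>
      ex (srt (quot K \<theta>) X) x (\<theta> X `` {a}) = \<theta> X `` {ex (srt K X) x a}"
    unfolding quot_def by simp (rule un, auto intro!: congruentI equiv_class_eq[OF eq[OF X]] D)
  show "finite Y \<Longrightarrow> s \<in> HomW \<Theta> X Y \<Longrightarrow> a \<in> carr (srt K X) \<Longrightarrow>
      sub (quot K \<theta>) X Y s (\<theta> X `` {a}) = \<theta> Y `` {sub K X Y s a}"
    unfolding quot_def by simp (rule un, auto intro!: congruentI equiv_class_eq[OF eq] D)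
qed (simp_all add: quot_def)

lemma closed_halmos_quot:
  assumes K: "closed_halmos \<Theta> K" and cong: "congruence \<Theta> K \<theta>"
  shows "closed_halmos \<Theta> (quot K \<theta>)"
  unfolding closed_halmos_def closed_extba_def
  by (auto simp: quot_srt[OF cong] closed_halmosD[OF K] elim!: quotientE intro!: quotientI)

text \<open>Only the values of \<open>g\<close> on classes matter, so the induced map may be given
  by a bare choice of representatives or by its restriction to the carriers; both forms occur
  below.\<close>

lemma halmos_hom_quot:
  assumes K: "closed_halmos \<Theta> K" and cong: "congruence \<Theta> K \<theta>" and h: "halmos_hom \<Theta> K L h"
    and g: "\<And>X a. finite X \<Longrightarrow> a \<in> carr (srt K X) \<Longrightarrow> g X (\<theta> X `` {a}) = h X a"
  shows "halmos_hom \<Theta> (quot K \<theta>) L g"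
  by (rule halmos_homI)
    (auto simp: quot_srt[OF cong] closed_halmosD[OF K] halmos_homD[OF h] g elim!: quotientE)

text \<open>A map constant on a class can be read off from any chosen member; this is how
  \<open>h\<close> descends to the quotient.\<close>

lemma quot_lift:
  assumes cong: "congruence \<Theta> K \<theta>" and X: "finite X" and a: "a \<in> carr (srt K X)"
    and ker: "\<And>b. (a, b) \<in> \<theta> X \<Longrightarrow> h X a = h X b"
  shows "h X (SOME b. b \<in> \<theta> X `` {a}) = h X a"
proof -
  have "a \<in> \<theta> X `` {a}" using equiv_class_self[OF congruenceD(1)[OF cong X] a] .
  then have "(SOME b. b \<in> \<theta> X `` {a}) \<in> \<theta> X `` {a}" by (rule someI)
  then show ?thesis using ker by simp
qed

section \<open>The algebra of formulas is free\<close>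

text \<open>A formula does not determine its sort (\<open>FZero\<close> lies in all of them), so the
  sort is an argument. It comes after the formula because at \<open>FSub\<close> the recursion
  continues in the source sort \<open>Z\<close>.\<close>

primrec interp ::
  "('x, ('f, 'x) tm set, 'b) halmos \<Rightarrow> ('x, ('f, 'x) tm set) fm \<Rightarrow> 'x set \<Rightarrow> 'b" where
  "interp L (FEq w w') X = equ (srt L X) w w'"
| "interp L FZero X = zero (srt L X)"
| "interp L FOne X = one (srt L X)"
| "interp L (FNeg u) X = neg (srt L X) (interp L u X)"
| "interp L (FMeet u v) X = meet (srt L X) (interp L u X) (interp L v X)"
| "interp L (FJoin u v) X = join (srt L X) (interp L u X) (interp L v X)"
| "interp L (FEx x u) X = ex (srt L X) x (interp L u X)"
| "interp L (FSub Z s u) X = sub L Z X s (interp L u Z)"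

lemma abs_free_simps [simp]:
  "carr (srt (abs_free \<Theta>) X) = {u. fm_sort \<Theta> X u}"
  "zero (srt (abs_free \<Theta>) X) = FZero"
  "one (srt (abs_free \<Theta>) X) = FOne"
  "neg (srt (abs_free \<Theta>) X) = FNeg"
  "meet (srt (abs_free \<Theta>) X) = FMeet"
  "join (srt (abs_free \<Theta>) X) = FJoin"
  "ex (srt (abs_free \<Theta>) X) = FEx"
  "equ (srt (abs_free \<Theta>) X) = FEq"
  "sub (abs_free \<Theta>) X Y = FSub X"
  by (simp_all add: abs_free_def fun_eq_iff)

lemma closed_halmos_abs_free: "closed_halmos \<Theta> (abs_free \<Theta>)"
  unfolding closed_halmos_def closed_extba_def by (auto intro: fm_sort.intros)

lemma interp_closed:
  assumes "closed_halmos \<Theta> L" and "fm_sort \<Theta> X u" and "finite X"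
  shows "interp L u X \<in> carr (srt L X)"
  using assms(2,3) by induction (simp_all add: closed_halmosD[OF assms(1)])

lemma halmos_hom_interp:
  assumes "closed_halmos \<Theta> L"
  shows "halmos_hom \<Theta> (abs_free \<Theta>) L (\<lambda>X u. interp L u X)"
  by (rule halmos_homI) (simp_all add: interp_closed[OF assms])

text \<open>The quotient of the formulas by the kernel of the interpretation embeds in
  \<open>L\<close> and so satisfies the Halmos axioms. Hence this kernel is one of the congruences
  whose intersection is \<open>fm_cong\<close>.\<close>

lemma fm_cong_interp:
  assumes "wf_variety \<Theta>" and L: "halmos_algebra \<Theta> L"
  obtains \<theta> where "congruence \<Theta> (abs_free \<Theta>) \<theta>"
    and "halmos_algebra \<Theta> (quot (abs_free \<Theta>) \<theta>)"
    and "\<And>X u v. (u, v) \<in> \<theta> X \<longleftrightarrow> fm_sort \<Theta> X u \<and> fm_sort \<Theta> X v \<and> interp L u X = interp L v X"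
proof
  let ?h = "\<lambda>X u. interp L u X"
  let ?\<theta> = "\<lambda>X. {(u, v). fm_sort \<Theta> X u \<and> fm_sort \<Theta> X v \<and> ?h X u = ?h X v}"
  \<comment> \<open>The map induced on classes. It is injective because \<open>?\<theta>\<close> is
    exactly the kernel of \<open>?h\<close>.\<close>
  let ?g = "\<lambda>X A. ?h X (SOME u. u \<in> A)"
  have h: "halmos_hom \<Theta> (abs_free \<Theta>) L ?h"
    using closed_halmos_algebra[OF L] by (rule halmos_hom_interp)
  show cong: "congruence \<Theta> (abs_free \<Theta>) ?\<theta>"
    using congruence_kernel[OF closed_halmos_abs_free h] by simp
  have g: "?g X (?\<theta> X `` {u}) = ?h X u" if "finite X" "fm_sort \<Theta> X u" for X u
    using quot_lift[OF cong that(1), of u ?h] that(2) by simp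
  have inj: "inj_on (?g X) (carr (srt (quot (abs_free \<Theta>) ?\<theta>) X))" if X: "finite X" for X
  proof (rule inj_onI)
    fix A B
    assume "A \<in> carr (srt (quot (abs_free \<Theta>) ?\<theta>) X)" "B \<in> carr (srt (quot (abs_free \<Theta>) ?\<theta>) X)"
      and AB: "?g X A = ?g X B"
    then obtain u v where uv: "fm_sort \<Theta> X u" "A = ?\<theta> X `` {u}" "fm_sort \<Theta> X v" "B = ?\<theta> X `` {v}"
      unfolding quot_srt(1)[OF cong X] abs_free_simps by (blast elim: quotientE)
    then have "?h X u = ?h X v" using AB g[OF X, of u] g[OF X, of v] by simp
    with uv show "A = B" by auto
  qed
  have "halmos_hom \<Theta> (quot (abs_free \<Theta>) ?\<theta>) L ?g"
    by (rule halmos_hom_quot[OF closed_halmos_abs_free cong h]) (use g in simp)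
  then show "halmos_algebra \<Theta> (quot (abs_free \<Theta>) ?\<theta>)"
    by (rule halmos_algebra_inj_hom[OF assms(1) closed_halmos_quot[OF closed_halmos_abs_free cong] L])
      (rule inj)
qed simp

text \<open>\<open>L\<close> is only a witness that the family whose intersection defines \<open>fm_cong\<close> is nonempty.\<close>

lemma congruence_fm_cong:
  assumes "wf_variety \<Theta>" and "halmos_algebra \<Theta> L"
  shows "congruence \<Theta> (abs_free \<Theta>) (fm_cong \<Theta>)"
proof -
  let ?F = "{\<theta>. congruence \<Theta> (abs_free \<Theta>) \<theta> \<and> halmos_algebra \<Theta> (quot (abs_free \<Theta>) \<theta>)}"
  have "?F \<noteq> {}"
  proof (rule fm_cong_interp[OF assms])
    fix \<theta>
    assume "congruence \<Theta> (abs_free \<Theta>) \<theta>" "halmos_algebra \<Theta> (quot (abs_free \<Theta>) \<theta>)"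
    then show "?F \<noteq> {}" by auto
  qed
  then have "congruence \<Theta> (abs_free \<Theta>) (\<lambda>X. \<Inter>\<theta>\<in>?F. \<theta> X)"
    by (intro congruence_Inter) auto
  \<comment> \<open>\<open>fm_cong\<close> intersects the relations at each sort separately; as an
    intersection indexed by whole families it has the form of
    \<open>congruence_Inter\<close>.\<close>
  moreover have "fm_cong \<Theta> = (\<lambda>X. \<Inter>\<theta>\<in>?F. \<theta> X)"
    by (auto simp: fm_cong_def fun_eq_iff)
  ultimately show ?thesis by simp
qed

section \<open>The quotient \<open>Phi\<close> and its universal property\<close>

lemma Formulas_cases:
  assumes "wf_variety \<Theta>" and "halmos_algebra \<Theta> L" and "finite X" and "a \<in> Formulas \<Theta> X"
  obtains u where "fm_sort \<Theta> X u" and "a = fm_cong \<Theta> X `` {u}"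
  using assms(4) quot_srt(1)[OF congruence_fm_cong[OF assms(1,2)] assms(3)]
  by (auto simp: Phi_def elim: quotientE)

text \<open>The law holds in each quotient by one of the intersected congruences, so the pair of
  \<open>FMeet u (FNeg u)\<close> and \<open>FZero\<close> lies in each of them, hence in
  \<open>fm_cong\<close>. It will exclude that a proper filter contains both a formula and its
  negation.\<close>

lemma Phi_complement:
  assumes wf: "wf_variety \<Theta>" and L: "halmos_algebra \<Theta> L" and X: "finite X"
    and "a \<in> Formulas \<Theta> X"
  shows "meet (srt (Phi \<Theta>) X) a (neg (srt (Phi \<Theta>) X) a) = zero (srt (Phi \<Theta>) X)"
proof -
  note cong = congruence_fm_cong[OF wf L]
  obtain u where u: "fm_sort \<Theta> X u" "a = fm_cong \<Theta> X `` {u}"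
    using Formulas_cases[OF assms] .
  have "(FMeet u (FNeg u), FZero) \<in> \<theta> X"
    if \<theta>: "congruence \<Theta> (abs_free \<Theta>) \<theta>" and H: "halmos_algebra \<Theta> (quot (abs_free \<Theta>) \<theta>)" for \<theta>
  proof -
    let ?Q = "quot (abs_free \<Theta>) \<theta>"
    have "boolean_axioms (srt ?Q X)"
      using H[unfolded halmos_algebra_def, THEN conjunct1, rule_format, OF X]
      by (simp add: extended_boolean_algebra_def)
    moreover have "\<theta> X `` {u} \<in> carr (srt ?Q X)"
      using u(1) by (simp add: quot_srt[OF \<theta> X] quotientI)
    ultimately have "meet (srt ?Q X) (\<theta> X `` {u}) (neg (srt ?Q X) (\<theta> X `` {u})) = zero (srt ?Q X)"
      by (rule boolean_axiomsD(7))
    then have "\<theta> X `` {FMeet u (FNeg u)} = \<theta> X `` {FZero}"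
      using u(1) by (simp add: quot_srt[OF \<theta> X] fm_sort.intros)
    then show ?thesis
      by (rule eq_equiv_class[OF _ congruenceD(1)[OF \<theta> X]]) (simp add: fm_sort.intros)
  qed
  then have "(FMeet u (FNeg u), FZero) \<in> fm_cong \<Theta> X" by (auto simp: fm_cong_def)
  then have "fm_cong \<Theta> X `` {FMeet u (FNeg u)} = fm_cong \<Theta> X `` {FZero}"
    by (rule equiv_class_eq[OF congruenceD(1)[OF cong X]])
  then show ?thesis
    using u by (simp add: Phi_def quot_srt[OF cong X] fm_sort.intros)
qed

lemma closed_halmos_Phi:
  assumes "wf_variety \<Theta>" and "halmos_algebra \<Theta> L"
  shows "closed_halmos \<Theta> (Phi \<Theta>)"
  unfolding Phi_def using closed_halmos_quot[OF closed_halmos_abs_free congruence_fm_cong[OF assms]] .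

text \<open>Formulas are built from equalities and constants by the operations, all of which a
  homomorphism preserves, so induction on the formula leaves no choice for its value.\<close>

lemma Phi_hom_unique:
  assumes wf: "wf_variety \<Theta>" and L: "halmos_algebra \<Theta> L" and h: "halmos_hom \<Theta> (Phi \<Theta>) L h"
    and "fm_sort \<Theta> X u" and "finite X"
  shows "h X (fm_cong \<Theta> X `` {u}) = interp L u X"
proof -
  note Q = quot_srt[OF congruence_fm_cong[OF wf L], folded Phi_def]
  note hm = halmos_homD[OF h]
  have cls: "fm_cong \<Theta> X `` {u} \<in> Formulas \<Theta> X" if "finite X" "fm_sort \<Theta> X u" for X u
    using that by (simp add: Q(1) quotientI)
  show ?thesis
    using assms(4,5)
  proof induction
    case (1 w X w')
    then show ?case using hm(8)[of X w w'] by (simp add: Q)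
  next
    case (2 X)
    then show ?case using hm(2)[of X] by (simp add: Q)
  next
    case (3 X)
    then show ?case using hm(3)[of X] by (simp add: Q)
  next
    case (4 X u)
    then show ?case using hm(4)[OF _ cls[of X u]] by (simp add: Q)
  next
    case (5 X u v)
    then show ?case using hm(5)[OF _ cls[of X u] cls[of X v]] by (simp add: Q)
  next
    case (6 X u v)
    then show ?case using hm(6)[OF _ cls[of X u] cls[of X v]] by (simp add: Q)
  next
    case (7 x X u)
    then show ?case using hm(7)[OF _ _ cls[of X u], of x] by (simp add: Q)
  next
    case (8 X Y s u)
    then show ?case using hm(9)[OF _ _ _ cls[of X u], of Y s] by (simp add: Q)
  qed
qed

text \<open>Existence: the interpretation in \<open>L\<close> is constant on the classes of
  \<open>fm_cong\<close>, whose intersection involves its kernel, and therefore descends.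
  Uniqueness: any two homomorphisms equal the interpretation on classes and are undefined
  elsewhere.\<close>

lemma Phi_free:
  assumes wf: "wf_variety \<Theta>" and L: "halmos_algebra \<Theta> L"
  shows "\<exists>!h. h \<in> Halmos_Hom \<Theta> (Phi \<Theta>) L"
proof (rule ex_ex1I)
  let ?i = "\<lambda>X u. interp L u X"
  \<comment> \<open>The two restrictions make the map undefined outside the finite sorts and the
    carriers, as \<open>Halmos_Hom\<close> requires.\<close>
  let ?g = "\<lambda>X \<in> {X. finite X}. \<lambda>A \<in> Formulas \<Theta> X. ?i X (SOME u. u \<in> A)"
  note cong = congruence_fm_cong[OF wf L]
  have i: "halmos_hom \<Theta> (abs_free \<Theta>) L ?i"
    using closed_halmos_algebra[OF L] by (rule halmos_hom_interp)
  have ker: "?i X u = ?i X v" if "(u, v) \<in> fm_cong \<Theta> X" for X u v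
  proof (rule fm_cong_interp[OF wf L])
    fix \<theta>
    assume "congruence \<Theta> (abs_free \<Theta>) \<theta>" "halmos_algebra \<Theta> (quot (abs_free \<Theta>) \<theta>)"
      and \<theta>: "\<And>X u v. (u, v) \<in> \<theta> X \<longleftrightarrow>
        fm_sort \<Theta> X u \<and> fm_sort \<Theta> X v \<and> interp L u X = interp L v X"
    then have "(u, v) \<in> \<theta> X" using that by (auto simp: fm_cong_def)
    then show ?thesis by (simp add: \<theta>)
  qed
  have "?g X (fm_cong \<Theta> X `` {u}) = ?i X u" if X: "finite X" and u: "fm_sort \<Theta> X u" for X u
    using quot_lift[OF cong X, of u ?i] u ker X quot_srt(1)[OF cong X]
    by (simp add: Phi_def quotientI)
  then have hom: "halmos_hom \<Theta> (Phi \<Theta>) L ?g"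
    unfolding Phi_def
    by (intro halmos_hom_quot[OF closed_halmos_abs_free cong i]) (simp add: Phi_def)
  then have "?g \<in> Halmos_Hom \<Theta> (Phi \<Theta>) L"
    using halmos_homD(1)[OF hom] by (auto simp: Halmos_Hom_def)
  then show "\<exists>h. h \<in> Halmos_Hom \<Theta> (Phi \<Theta>) L" by blast
next
  fix h h'
  assume h: "h \<in> Halmos_Hom \<Theta> (Phi \<Theta>) L" and h': "h' \<in> Halmos_Hom \<Theta> (Phi \<Theta>) L"
  show "h = h'"
  proof (rule PiE_ext)
    show "h \<in> (\<Pi>\<^sub>E X \<in> {X. finite X}. Formulas \<Theta> X \<rightarrow>\<^sub>E carr (srt L X))"
      and "h' \<in> (\<Pi>\<^sub>E X \<in> {X. finite X}. Formulas \<Theta> X \<rightarrow>\<^sub>E carr (srt L X))"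
      using h h' by (simp_all add: Halmos_Hom_def)
    fix X :: "'b set" assume X: "X \<in> {X. finite X}"
    show "h X = h' X"
    proof (rule PiE_ext)
      show "h X \<in> Formulas \<Theta> X \<rightarrow>\<^sub>E carr (srt L X)" and "h' X \<in> Formulas \<Theta> X \<rightarrow>\<^sub>E carr (srt L X)"
        using h h' X unfolding Halmos_Hom_def by (blast dest: PiE_mem)+
      fix a assume "a \<in> Formulas \<Theta> X"
      then obtain u where u: "fm_sort \<Theta> X u" "a = fm_cong \<Theta> X `` {u}"
        using Formulas_cases[OF wf L] X by blast
      have "halmos_hom \<Theta> (Phi \<Theta>) L h" "halmos_hom \<Theta> (Phi \<Theta>) L h'"
        using h h' by (simp_all add: Halmos_Hom_def)
      note this[THEN Phi_hom_unique[OF wf L _ u(1)]]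
      then show "h X a = h' X a" using X u(2) by simp
    qed
  qed
qed

section \<open>Saturation\<close>

text \<open>\<open>Val\<close> is a definite description, so its properties come from unique
  existence, that is, from freeness of \<open>Phi\<close> applied to the Halmos algebra
  \<open>Hal\<close>.\<close>

lemma halmos_hom_Val:
  assumes "wf_variety \<Theta>" and "in_variety \<Theta> H"
  shows "halmos_hom \<Theta> (Phi \<Theta>) (Hal \<Theta> H) (Val \<Theta> H)"
  using theI'[OF Phi_free[OF assms(1) halmos_algebra_Hal[OF assms]]]
  by (simp add: Val_def Halmos_Hom_def)

text \<open>\<open>LKer\<close> of \<open>\<mu>\<close> is the preimage under \<open>Val\<close> of
  the principal ultrafilter at \<open>\<mu>\<close>; it is proper because \<open>zero\<close> is
  sent to the empty set.\<close>

lemma proper_filter_LKer: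
  assumes wf: "wf_variety \<Theta>" and H: "in_variety \<Theta> H" and X: "finite X" and \<mu>: "\<mu> \<in> Points \<Theta> X H"
  shows "proper_filter (srt (Phi \<Theta>) X) (LKer \<Theta> H X \<mu>)"
proof -
  note cl = closed_halmosD[OF closed_halmos_Phi[OF wf halmos_algebra_Hal[OF wf H]] X]
  note hm = halmos_homD[OF halmos_hom_Val[OF wf H] X]
  \<comment> \<open>\<open>le a b\<close> is \<open>meet a b = a\<close>, which \<open>Val\<close>
    turns into an inclusion.\<close>
  have "b \<in> LKer \<Theta> H X \<mu>" if "a \<in> LKer \<Theta> H X \<mu>" "b \<in> Formulas \<Theta> X" "le (srt (Phi \<Theta>) X) a b" for a b
    using that hm(5)[of a b] by (auto simp: LKer_def le_def Hal_def)
  then show ?thesis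
    using \<mu> by (auto simp: proper_filter_def LKer_def cl hm Hal_def)
qed

text \<open>The meet of \<open>T0\<close> stays in \<open>T\<close> since filters are closed under
  meets. It is described by what its points satisfy, a form that passes through the induction on
  \<open>T0\<close>.\<close>

lemma proper_filter_finite_meet:
  assumes wf: "wf_variety \<Theta>" and H: "in_variety \<Theta> H" and X: "finite X"
    and T: "proper_filter (srt (Phi \<Theta>) X) T" and "finite T0" and "T0 \<subseteq> T"
  obtains u where "u \<in> T" and "\<forall>\<mu>\<in>Val \<Theta> H X u. T0 \<subseteq> LKer \<Theta> H X \<mu>"
proof -
  have TF: "T \<subseteq> Formulas \<Theta> X" using T by (simp add: proper_filter_def)
  have "\<exists>u\<in>T. \<forall>\<mu>\<in>Val \<Theta> H X u. T0 \<subseteq> LKer \<Theta> H X \<mu>"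
    using assms(5,6)
  proof induction
    case empty
    \<comment> \<open>The empty meet is \<open>one\<close>.\<close>
    have "one (srt (Phi \<Theta>) X) \<in> T" using T by (simp add: proper_filter_def)
    then show ?case by auto
  next
    case (insert v T0)
    then obtain u where u: "u \<in> T" "\<forall>\<mu>\<in>Val \<Theta> H X u. T0 \<subseteq> LKer \<Theta> H X \<mu>" by auto
    have v: "v \<in> T" using insert.prems by simp
    have "Val \<Theta> H X (meet (srt (Phi \<Theta>) X) v u) = Val \<Theta> H X v \<inter> Val \<Theta> H X u"
      using halmos_homD(5)[OF halmos_hom_Val[OF wf H] X, of v u] u(1) v TF
      by (auto simp: Hal_def)
    then have "\<forall>\<mu>\<in>Val \<Theta> H X (meet (srt (Phi \<Theta>) X) v u). insert v T0 \<subseteq> LKer \<Theta> H X \<mu>"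
      using u(2) v TF by (auto simp: LKer_def)
    moreover have "meet (srt (Phi \<Theta>) X) v u \<in> T" using T u(1) v by (simp add: proper_filter_def)
    ultimately show ?case by blast
  qed
  with that show ?thesis by blast
qed

theorem theorem3p33:
  fixes \<Theta> :: "('f, 'x) variety" and H :: "('f, 'h) algebra"
  assumes "infinite (UNIV :: 'x set)"
    and "wf_variety \<Theta>"
    and "in_variety \<Theta> H"
    and "logically_noetherian \<Theta> H"
  shows "LG_saturated \<Theta> H"
  unfolding LG_saturated_def
proof (intro allI impI, elim conjE)
  note wf = assms(2) and H = assms(3)
  note hm = halmos_homD[OF halmos_hom_Val[OF wf H]]
  fix X T
  assume X: "finite X" and ultra: "is_ultrafilter (srt (Phi \<Theta>) X) T" and Th: "Th \<Theta> H X \<subseteq> T"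
  let ?B = "srt (Phi \<Theta>) X"
  have T: "proper_filter ?B T" using ultra by (simp add: is_ultrafilter_def)
  then have TF: "T \<subseteq> Formulas \<Theta> X" by (simp add: proper_filter_def)
  obtain T0 where T0: "T0 \<subseteq> T" "finite T0" "TL \<Theta> H X T0 = TL \<Theta> H X T"
    using assms(4)[unfolded logically_noetherian_def, rule_format, OF conjI[OF X TF]] by blast
  obtain u where u: "u \<in> T" "\<forall>\<mu>\<in>Val \<Theta> H X u. T0 \<subseteq> LKer \<Theta> H X \<mu>"
    using proper_filter_finite_meet[OF wf H X T T0(2,1)] .
  have uF: "u \<in> Formulas \<Theta> X" using u(1) TF by blast
  \<comment> \<open>\<open>TL\<close> consists of points, so the \<open>\<mu>\<close> later taken
    from the value of \<open>u\<close> must be known to be one.\<close>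
  have Val_u: "Val \<Theta> H X u \<subseteq> Points \<Theta> X H" using hm(1)[OF X uF] by (simp add: Hal_def)
  have "Val \<Theta> H X u \<noteq> {}"
  proof
    assume "Val \<Theta> H X u = {}"
    then have "Val \<Theta> H X (neg ?B u) = Points \<Theta> X H" using hm(4)[OF X uF] by (simp add: Hal_def)
    moreover have "neg ?B u \<in> Formulas \<Theta> X"
      using closed_halmosD(3)[OF closed_halmos_Phi[OF wf halmos_algebra_Hal[OF wf H]] X uF] .
    ultimately have "neg ?B u \<in> T" using Th by (auto simp: Th_def)
    \<comment> \<open>This meet is \<open>zero\<close>, which a proper filter excludes.\<close>
    then have "meet ?B u (neg ?B u) \<in> T" using T u(1) by (simp add: proper_filter_def)
    then show False
      using T Phi_complement[OF wf halmos_algebra_Hal[OF wf H] X uF] by (simp add: proper_filter_def)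
  qed
  then obtain \<mu> where \<mu>: "\<mu> \<in> Val \<Theta> H X u" by blast
  with u(2) Val_u have "\<mu> \<in> TL \<Theta> H X T0" by (auto simp: TL_def)
  then have "\<mu> \<in> Points \<Theta> X H" "T \<subseteq> LKer \<Theta> H X \<mu>" unfolding T0(3) by (auto simp: TL_def)
  \<comment> \<open>Maximality of \<open>T\<close> applies because \<open>LKer\<close> of
    \<open>\<mu>\<close> is itself a proper filter.\<close>
  then show "\<exists>\<mu> \<in> Points \<Theta> X H. T = LKer \<Theta> H X \<mu>"
    using ultra proper_filter_LKer[OF wf H X] unfolding is_ultrafilter_def by blast
qed

end
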